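(* Let $n \in \mathbb{Z}^{+}$ and, for $1 \leq i \leq n+1$, let $m_i,d_i$ be positive integers with $0<\frac{m_i}{d_i}<1$. Let $p$ be a prime with $p \equiv 1 \pmod{d_i}$ for each $i$, and let $\rho_i=\bar{\omega}^{\frac{p-1}{d_i}}$ (a character of $\mathbb{F}_p^*$). Let $S:=\sum_{i=1}^{n+1}\frac{m_i}{d_i}$ and suppose $S \geq n-1$. Let $\delta:=\prod_{i=1}^{n+1}\Gamma_p\!\left(1-\frac{m_i}{d_i}\right)$ if $S=n-1$ and $\delta:=0$ otherwise. Then \[ {}_{n+1}G\left( \tfrac{m_1}{d_1}, \dotsc, \tfrac{m_{n+1}}{d_{n+1}} \right)_p \equiv {}_{n+1}F_n\left[ \begin{array}{cccc} \frac{m_1}{d_1}, & \frac{m_2}{d_2}, & \dotsc, & \frac{m_{n+1}}{d_{n+1}} \\ & 1, & \dotsc, & 1 \end{array} \Big| \; 1 \right]_{p-1} + \delta\cdot p \pmod{p^2}. \]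
   Context: $\omega$ is the Teichmüller character of $\mathbb{F}_p^*$; $\Gamma_p$ is Morita's $p$-adic gamma function. For real $x$, $\lfloor x\rfloor$ is the floor and $\langle x\rangle:=x-\lfloor x\rfloor$. For an odd prime $p$, $n\in\mathbb{Z}^+$ and $\frac{m_i}{d_i}\in\mathbb{Q}\cap\mathbb{Z}_p$ with $0<\frac{m_i}{d_i}<1$, define ${}_{n+1}G\left(\tfrac{m_1}{d_1},\dots,\tfrac{m_{n+1}}{d_{n+1}}\right)_p:=\frac{-1}{p-1}\sum_{j=0}^{p-2}\left((-1)^j\Gamma_p(\tfrac{j}{p-1})\right)^{n+1}\prod_{i=1}^{n+1}\frac{\Gamma_p(\langle \frac{m_i}{d_i}-\frac{j}{p-1}\rangle)}{\Gamma_p(\frac{m_i}{d_i})}(-p)^{-\lfloor \frac{m_i}{d_i}-\frac{j}{p-1}\rfloor}$. Rising factorial: $(a)_0:=1$, $(a)_k:=a(a+1)\cdots(a+k-1)$. Truncated hypergeometric series: ${}_rF_s\left[\begin{array}{ccc}a_1,&\dots,&a_r\\ &b_1,\dots,&b_s\end{array}\Big|\,z\right]_m:=\sum_{k=0}^{m}\frac{(a_1)_k\cdots(a_r)_k}{(b_1)_k\cdots(b_s)_k}\frac{z^k}{k!}$. Congruences are in $\mathbb{Z}_p$. *)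

theory Defs
  imports
    Complex_Main
    "HOL-Computational_Algebra.Polynomial_Factorial"
    "HOL-Number_Theory.Cong"
    "Berlekamp_Zassenhaus.Finite_Field"
begin

text \<open>
  Throughout, the prime \<open>p\<close> is the cardinality of a type of class \<^class>\<open>prime_card\<close>, as in
  the representation of the prime field by \<^typ>\<open>'p mod_ring\<close>. The ring of \<open>p\<close>-adic integers is
  the inverse limit of the rings \<open>\<int>/p\<^sup>n\<int>\<close>: an element is the sequence of its canonical
  residues modulo \<open>p\<^sup>n\<close>.
\<close>

typedef (overloaded) ('p :: prime_card) padic_int =
  "{f :: nat \<Rightarrow> int. \<forall>n. f n = f (Suc n) mod int CARD('p) ^ n}"
  morphisms padic_residue Abs_padic_int
  by (rule exI[of _ "\<lambda>_. 0"]) simp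

setup_lifting type_definition_padic_int

lemma mod_pow_Suc: "(a mod b ^ Suc n) mod b ^ n = a mod (b :: int) ^ n"
  by (rule mod_mod_cancel) simp

lemma padic_residue_Suc:
  "padic_residue (x :: 'p :: prime_card padic_int) (Suc n) mod int CARD('p) ^ n = padic_residue x n"
  using padic_residue[of x] by (metis (mono_tags, lifting) mem_Collect_eq)

lemma padic_residue_mod_le:
  fixes x :: "'p :: prime_card padic_int"
  assumes "n \<le> m"
  shows "padic_residue x m mod int CARD('p) ^ n = padic_residue x n"
  using assms
proof (induction m rule: dec_induct)
  case base
  show ?case by (metis padic_residue_Suc mod_mod_trivial)
next
  case (step m)
  have "padic_residue x (Suc m) mod int CARD('p) ^ n
      = (padic_residue x (Suc m) mod int CARD('p) ^ m) mod int CARD('p) ^ n"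
    by (rule mod_mod_cancel[symmetric]) (use step in \<open>simp add: le_imp_power_dvd\<close>)
  then show ?case using step by (simp add: padic_residue_Suc)
qed

lemma padic_residue_eqI: "(\<And>n. padic_residue x n = padic_residue y n) \<Longrightarrow> x = y"
  by (simp add: padic_residue_inject[symmetric] fun_eq_iff)

instantiation padic_int :: (prime_card) comm_ring_1
begin

lift_definition zero_padic_int :: "'a padic_int" is "\<lambda>_. 0" by simp

lift_definition one_padic_int :: "'a padic_int" is "\<lambda>n. 1 mod int CARD('a) ^ n"
  by (simp only: mod_pow_Suc simp_thms)

lift_definition plus_padic_int :: "'a padic_int \<Rightarrow> 'a padic_int \<Rightarrow> 'a padic_int"
  is "\<lambda>f g n. (f n + g n) mod int CARD('a) ^ n"
  by (metis mod_pow_Suc mod_add_eq)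

lift_definition uminus_padic_int :: "'a padic_int \<Rightarrow> 'a padic_int"
  is "\<lambda>f n. (- f n) mod int CARD('a) ^ n"
  by (metis mod_pow_Suc mod_minus_eq)

lift_definition minus_padic_int :: "'a padic_int \<Rightarrow> 'a padic_int \<Rightarrow> 'a padic_int"
  is "\<lambda>f g n. (f n - g n) mod int CARD('a) ^ n"
  by (metis mod_pow_Suc mod_diff_eq)

lift_definition times_padic_int :: "'a padic_int \<Rightarrow> 'a padic_int \<Rightarrow> 'a padic_int"
  is "\<lambda>f g n. (f n * g n) mod int CARD('a) ^ n"
  by (metis mod_pow_Suc mod_mult_eq)

instance
proof
  fix a b c :: "'a padic_int"
  note rep = zero_padic_int.rep_eq one_padic_int.rep_eq plus_padic_int.rep_eq
    uminus_padic_int.rep_eq minus_padic_int.rep_eq times_padic_int.rep_eq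
  have self: "padic_residue x n mod int CARD('a) ^ n = padic_residue x n"
    for x :: "'a padic_int" and n
    by (metis padic_residue_Suc mod_mod_trivial)
  show "a * b * c = a * (b * c)"
    by (rule padic_residue_eqI) (simp add: rep mod_simps ac_simps)
  show "a * b = b * a"
    by (rule padic_residue_eqI) (simp add: rep ac_simps)
  show "1 * a = a"
    by (rule padic_residue_eqI) (simp add: rep mod_simps self)
  show "a + b + c = a + (b + c)"
    by (rule padic_residue_eqI) (simp add: rep mod_simps ac_simps)
  show "a + b = b + a"
    by (rule padic_residue_eqI) (simp add: rep ac_simps)
  show "0 + a = a"
    by (rule padic_residue_eqI) (simp add: rep self)
  show "- a + a = 0"
    by (rule padic_residue_eqI) (simp add: rep mod_simps)
  show "a - b = a + - b"
    by (rule padic_residue_eqI) (simp add: rep mod_simps)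
  show "(a + b) * c = a * c + b * c"
    by (rule padic_residue_eqI) (simp add: rep mod_simps algebra_simps)
  show "(0 :: 'a padic_int) \<noteq> 1"
  proof
    assume "(0 :: 'a padic_int) = 1"
    then have "padic_residue (0 :: 'a padic_int) 1 = padic_residue (1 :: 'a padic_int) 1"
      by simp
    then show False
      using nontriv[where 'a = 'a] by (simp add: zero_padic_int.rep_eq one_padic_int.rep_eq)
  qed
qed

end

lemma padic_residue_of_nat:
  "padic_residue (of_nat k :: 'p :: prime_card padic_int) n = int k mod int CARD('p) ^ n"
  by (induction k)
    (simp_all add: zero_padic_int.rep_eq one_padic_int.rep_eq plus_padic_int.rep_eq mod_simps)

instance padic_int :: (prime_card) idom
proof
  fix x y :: "'a padic_int"
  let ?p = "int CARD('a)"
  assume "x \<noteq> 0" "y \<noteq> 0"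
  then obtain a b where a: "padic_residue x a \<noteq> 0" and b: "padic_residue y b \<noteq> 0"
    by (metis padic_residue_eqI zero_padic_int.rep_eq)
  let ?u = "padic_residue x (a + b)" and ?v = "padic_residue y (a + b)"
  have nu: "\<not> ?p ^ a dvd ?u" and nv: "\<not> ?p ^ b dvd ?v"
    using a b padic_residue_mod_le[of a "a + b" x] padic_residue_mod_le[of b "a + b" y]
    by (simp_all add: dvd_eq_mod_eq_0)
  have p: "prime_elem ?p" using prime_card[where 'a = 'a] by simp
  show "x * y \<noteq> 0"
  proof
    assume "x * y = 0"
    then have "(?u * ?v) mod ?p ^ (a + b) = 0"
      by (metis times_padic_int.rep_eq zero_padic_int.rep_eq)
    then have "?p ^ (a + b) dvd ?u * ?v" by presburger
    from prime_elem_power_dvd_prod[OF this p]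
    obtain i j where ij: "i + j = a + b" "?p ^ i dvd ?u" "?p ^ j dvd ?v" by metis
    then have "a \<le> i \<or> b \<le> j" by linarith
    then show False
      using ij nu nv by (meson dvd_trans le_imp_power_dvd)
  qed
qed

instance padic_int :: (prime_card) ring_char_0
proof
  show "inj (of_nat :: nat \<Rightarrow> 'a padic_int)"
  proof
    fix k l :: nat
    assume eq: "(of_nat k :: 'a padic_int) = of_nat l"
    let ?n = "max k l"
    have p: "Suc 0 < CARD('a)" using nontriv[where 'a = 'a] by simp
    have "k < CARD('a) ^ ?n" "l < CARD('a) ^ ?n"
      using power_gt_expt[OF p, of ?n] by simp_all
    moreover have "int k mod int CARD('a) ^ ?n = int l mod int CARD('a) ^ ?n"
      using eq padic_residue_of_nat by metis
    ultimately show "k = l"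
      by (metis mod_less of_nat_eq_iff of_nat_mod of_nat_power)
  qed
qed

instance fract :: ("{idom,ring_char_0}") field_char_0
proof
  have "of_nat n = to_fract (of_nat n :: 'a)" for n
    by (induction n) simp_all
  then show "inj (of_nat :: nat \<Rightarrow> 'a fract)"
    by (auto intro!: injI)
qed

type_synonym 'p padic = "'p padic_int fract"

text \<open>
  The metric is the \<open>p\<close>-adic one: for \<open>x \<noteq> y\<close> the exponent below is the largest \<open>n\<close> with
  \<open>x \<equiv> y (mod p\<^sup>n)\<close>, i.e. the valuation of \<open>x - y\<close>.
\<close>

instantiation padic_int :: (prime_card) metric_space
begin

definition dist_padic_int :: "'a padic_int \<Rightarrow> 'a padic_int \<Rightarrow> real" where
  "dist x y = (if x = y then 0
     else 1 / real CARD('a) ^ (LEAST n. padic_residue x (Suc n) \<noteq> padic_residue y (Suc n)))"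

definition uniformity_padic_int :: "('a padic_int \<times> 'a padic_int) filter" where
  "uniformity_padic_int = (INF e\<in>{0<..}. principal {(x, y). dist x y < e})"

definition open_padic_int :: "'a padic_int set \<Rightarrow> bool" where
  "open_padic_int U \<longleftrightarrow> (\<forall>x\<in>U. eventually (\<lambda>(x', y). x' = x \<longrightarrow> y \<in> U) uniformity)"

instance
proof
  fix x y z :: "'a padic_int"
  show "uniformity = (INF e\<in>{0<..}. principal {(x, y :: 'a padic_int). dist x y < e})"
    by (rule uniformity_padic_int_def)
  show "open U \<longleftrightarrow> (\<forall>x\<in>U. eventually (\<lambda>(x', y). x' = x \<longrightarrow> y \<in> U) uniformity)"
    for U :: "'a padic_int set"
    by (rule open_padic_int_def)
  have p: "1 < real CARD('a)" using nontriv[where 'a = 'a] by simp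
  show "(dist x y = 0) = (x = y)"
    by (simp add: dist_padic_int_def)
  have nonneg: "0 \<le> dist u v" for u v :: "'a padic_int"
    by (simp add: dist_padic_int_def)
  have ge: "1 / real CARD('a) ^ k \<le> dist u v"
    if "padic_residue u (Suc k) \<noteq> padic_residue v (Suc k)" for u v :: "'a padic_int" and k
  proof -
    have "(LEAST n. padic_residue u (Suc n) \<noteq> padic_residue v (Suc n)) \<le> k"
      by (rule Least_le) (rule that)
    then show ?thesis
      using p that by (auto simp: dist_padic_int_def intro!: divide_left_mono power_increasing)
  qed
  show "dist x y \<le> dist x z + dist y z"
  proof (cases "x = y")
    case True
    then show ?thesis using nonneg by (simp add: dist_padic_int_def)
  next
    case False
    define k where "k = (LEAST n. padic_residue x (Suc n) \<noteq> padic_residue y (Suc n))"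
    obtain m where m: "padic_residue x m \<noteq> padic_residue y m"
      using False padic_residue_eqI by blast
    then have "padic_residue x (Suc m) \<noteq> padic_residue y (Suc m)"
      by (metis padic_residue_Suc)
    then have "padic_residue x (Suc k) \<noteq> padic_residue y (Suc k)"
      unfolding k_def by (rule LeastI)
    then have "padic_residue x (Suc k) \<noteq> padic_residue z (Suc k)
             \<or> padic_residue y (Suc k) \<noteq> padic_residue z (Suc k)"
      by metis
    then have "1 / real CARD('a) ^ k \<le> dist x z \<or> 1 / real CARD('a) ^ k \<le> dist y z"
      using ge by blast
    moreover have "dist x y = 1 / real CARD('a) ^ k"
      using False by (simp add: dist_padic_int_def k_def)
    ultimately show ?thesis
      using nonneg[of x z] nonneg[of y z] by linarith
  qed
qed

end

text \<open>The element of \<open>\<int>\<^sub>p\<close> given by a rational number in \<open>\<rat> \<inter> \<int>\<^sub>p\<close>.\<close>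

definition padic_int_of_rat :: "rat \<Rightarrow> 'p :: prime_card padic_int" where
  "padic_int_of_rat r = (THE z. to_fract z = of_rat r)"

definition padic_Gamma_nat :: "nat \<Rightarrow> 'p :: prime_card padic_int" where
  "padic_Gamma_nat n = (- 1) ^ n * (\<Prod>j | 0 < j \<and> j < n \<and> \<not> CARD('p) dvd j. of_nat j)"

text \<open>
  Morita's function: the limit of its values at positive integers \<open>n\<close> tending \<open>p\<close>-adically
  to \<open>x\<close>.
\<close>

definition padic_Gamma :: "'p :: prime_card padic_int \<Rightarrow> 'p padic_int" where
  "padic_Gamma x = Lim (inf (filtercomap of_nat (nhds x)) (principal {0<..})) padic_Gamma_nat"

abbreviation Gamma_rat :: "rat \<Rightarrow> 'p :: prime_card padic" where
  "Gamma_rat r \<equiv> to_fract (padic_Gamma (padic_int_of_rat r))"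

text \<open>
  The unique \<open>(p-1)\<close>-st root of unity of \<open>\<int>\<^sub>p\<close> in the given residue class, extended by \<open>0\<close>.
\<close>

definition teichmuller :: "'p :: prime_card mod_ring \<Rightarrow> 'p padic_int" where
  "teichmuller x = (if x = 0 then 0
     else THE z. z ^ (CARD('p) - 1) = 1 \<and> of_int (padic_residue z 1) = x)"

text \<open>The function \<open>\<^sub>n\<^sub>+\<^sub>1G(a\<^sub>1, \<dots>, a\<^sub>n\<^sub>+\<^sub>1)\<^sub>p\<close>, with values in \<open>\<rat>\<^sub>p\<close>.\<close>

definition padic_G :: "nat \<Rightarrow> (nat \<Rightarrow> rat) \<Rightarrow> 'p :: prime_card padic" where
  "padic_G n a = - 1 / of_nat (CARD('p) - 1) *
     (\<Sum>j = 0..CARD('p) - 2.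
        let t = of_nat j / of_nat (CARD('p) - 1) in
        ((- 1) ^ j * Gamma_rat t) ^ (n + 1) *
        (\<Prod>i = 1..n + 1. Gamma_rat (frac (a i - t)) / Gamma_rat (a i) *
           (- of_nat CARD('p)) powi (- \<lfloor>a i - t\<rfloor>)))"

definition trunc_hypergeom :: "'a :: field_char_0 list \<Rightarrow> 'a list \<Rightarrow> 'a \<Rightarrow> nat \<Rightarrow> 'a" where
  "trunc_hypergeom as bs z m =
     (\<Sum>k = 0..m. (\<Prod>a\<leftarrow>as. pochhammer a k) / (\<Prod>b\<leftarrow>bs. pochhammer b k) * z ^ k / fact k)"

text \<open>
  Congruence in \<open>\<int>\<^sub>p\<close> modulo \<open>p\<^sup>k\<close>, for elements of \<open>\<rat>\<^sub>p\<close>; both sides are required to be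
  \<open>p\<close>-adic integers.
\<close>

definition padic_cong :: "nat \<Rightarrow> 'p :: prime_card padic \<Rightarrow> 'p padic \<Rightarrow> bool" where
  "padic_cong k x y \<longleftrightarrow>
     (\<exists>u v. x = to_fract u \<and> y = to_fract v \<and> of_nat CARD('p) ^ k dvd u - v)"

end

theory Submission
  imports Defs "HOL-Number_Theory.Residues"
begin

text \<open>
  Put \<open>a\<^sub>i = (p - 1 - s\<^sub>i) / (p - 1)\<close>, \<open>T\<^sub>s(X) = (X + 1) \<cdots> (X + s)\<close> and \<open>V(m) = T\<^sub>m(m p)\<close>. Modulo
  \<open>p\<^sup>2\<close>, the \<open>i\<close>-th factor of the \<open>k\<close>-th summand of \<open>G\<close> is \<open>V(s\<^sub>i + k) / (V(s\<^sub>i) V(k))\<close>, whether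
  or not it carries the extra factor \<open>-p\<close>. Expanding to first order in \<open>p\<close> turns this into the
  corresponding factor of the hypergeometric series plus \<open>p k T'\<^sub>s\<^sub>i(k) / s\<^sub>i!\<close>. With \<open>-1 / (p - 1) \<equiv> 1 + p\<close>
  and \<open>P = \<Prod>\<^sub>i T\<^sub>s\<^sub>i\<close>, the difference of \<open>G\<close> and the series is therefore \<open>p / \<Prod>\<^sub>i s\<^sub>i!\<close> times
  the sum of \<open>(X P)'(k)\<close> over \<open>k < p\<close>. As \<open>P\<close> has degree \<open>(p - 1) (n + 1 - S) \<le> 2 (p - 1)\<close>, the
  power sums modulo \<open>p\<close> reduce that sum to the coefficient of \<open>P\<close> at \<open>2 (p - 1)\<close>, which is \<open>1\<close> if
  \<open>S = n - 1\<close> and \<open>0\<close> otherwise; and \<open>\<Gamma>\<^sub>p(1 - a\<^sub>i) \<equiv> 1 / s\<^sub>i!\<close> modulo \<open>p\<close>.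
\<close>

section \<open>First-order expansion of integer polynomials, and products over reflected index
  sets\<close>

text \<open>Taylor expansion without division by factorials: passing from \<open>q\<close> to
  \<open>pCons a q\<close> multiplies the error by \<open>x + h\<close> and adds
  \<open>h\<^sup>2 * poly (pderiv q) x\<close>.\<close>

lemma poly_add_cong:
  fixes q :: "int poly"
  shows "[poly q (x + h) = poly q x + h * poly (pderiv q) x] (mod h\<^sup>2)"
proof (induction q)
  case 0
  then show ?case by simp
next
  case (pCons a q)
  let ?e = "poly q (x + h) - (poly q x + h * poly (pderiv q) x)"
  have "poly (pCons a q) (x + h) - (poly (pCons a q) x + h * poly (pderiv (pCons a q)) x)
      = (x + h) * ?e + h\<^sup>2 * poly (pderiv q) x"
    by (simp add: pderiv_pCons algebra_simps power2_eq_square)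
  moreover have "h\<^sup>2 dvd ?e"
    using pCons.IH by (simp add: cong_iff_dvd_diff)
  ultimately show ?case
    by (simp add: cong_iff_dvd_diff)
qed

text \<open>
  The reflection \<open>j \<mapsto> q - j\<close> shows that \<open>\<Prod>(X + j)\<close> takes the same value at \<open>0\<close> and \<open>-q\<close>, so
  its derivative at \<open>0\<close> is divisible by \<open>q\<close>.
\<close>

lemma prod_shift_cong:
  fixes q :: nat and A :: "nat set" and c :: int
  assumes "finite A" "even (card A)" "q > 0"
    and A: "\<And>j. j \<in> A \<Longrightarrow> j \<le> q \<and> q - j \<in> A"
  shows "[(\<Prod>j\<in>A. c * int q + int j) = (\<Prod>j\<in>A. int j)] (mod (int q)\<^sup>2)"
proof -
  define R where "R = (\<Prod>j\<in>A. [:int j, 1:])"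
  have R: "poly R x = (\<Prod>j\<in>A. x + int j)" for x
    by (simp add: R_def poly_prod add.commute)
  have "poly R (- int q) = (\<Prod>j\<in>A. - int (q - j))"
    unfolding R by (rule prod.cong) (use A in \<open>auto simp: of_nat_diff\<close>)
  also have "\<dots> = (\<Prod>j\<in>A. int (q - j))"
    using assms(2) by (simp add: prod_uminus)
  also have "\<dots> = (\<Prod>j\<in>A. int j)"
    by (rule prod.reindex_bij_witness[where i = "\<lambda>j. q - j" and j = "\<lambda>j. q - j"]) (use A in auto)
  finally have sym: "poly R (- int q) = poly R 0"
    by (simp add: R)
  have "(int q)\<^sup>2 dvd int q * poly (pderiv R) 0"
    using poly_add_cong[of R 0 "- int q"] sym by (simp add: cong_iff_dvd_diff)
  then have d: "int q dvd poly (pderiv R) 0"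
    using \<open>q > 0\<close> by (simp add: power2_eq_square)
  have "[poly R (c * int q) = poly R 0 + c * int q * poly (pderiv R) 0] (mod (int q)\<^sup>2)"
    using poly_add_cong[of R 0 "c * int q"]
    by (auto intro: cong_dvd_modulus simp: power_mult_distrib)
  moreover have "[c * int q * poly (pderiv R) 0 = 0] (mod (int q)\<^sup>2)"
    using d by (auto simp: cong_0_iff power2_eq_square)
  ultimately have "[poly R (c * int q) = poly R 0 + 0] (mod (int q)\<^sup>2)"
    by (meson cong_add_lcancel cong_trans)
  then show ?thesis by (simp add: R)
qed

text \<open>\<open>{1..p - 1}\<close> is stable under the reflection and has even size since
  \<open>p\<close> is odd. To second order, a block of nonzero residues thus does not feel its
  position.\<close>

lemma prod_block_cong:
  fixes p :: nat and c :: int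
  assumes "prime p" "odd p"
  shows "[(\<Prod>l = 1..p - 1. c * int p + int l) = fact (p - 1)] (mod (int p)\<^sup>2)"
proof -
  have "[(\<Prod>l = 1..p - 1. c * int p + int l) = (\<Prod>l = 1..p - 1. int l)] (mod (int p)\<^sup>2)"
    by (rule prod_shift_cong) (use assms prime_gt_0_nat[of p] in auto)
  then show ?thesis by (simp add: fact_prod)
qed

text \<open>In the factorisation of \<open>x ^ p - y ^ p\<close> the factor \<open>x - y\<close>
  supplies \<open>p ^ k\<close>; the cofactor has \<open>p\<close> terms, all congruent to
  \<open>y ^ (p - 1)\<close> modulo \<open>p\<close>, and supplies one more
  \<open>p\<close>.\<close>

lemma cong_pow_prime_lift:
  fixes x y :: int
  assumes "[x = y] (mod int p ^ k)" "k \<ge> 1"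
  shows "[x ^ p = y ^ p] (mod int p ^ Suc k)"
proof -
  have "int p dvd int p ^ k" using assms(2) by simp
  then have xy: "[x = y] (mod int p)" using assms(1) cong_dvd_modulus by blast
  have "[(\<Sum>i<p. y ^ (p - Suc i) * x ^ i) = (\<Sum>i<p. y ^ (p - Suc i) * y ^ i)] (mod int p)"
    by (intro cong_sum cong_mult cong_pow xy cong_refl)
  also have "(\<Sum>i<p. y ^ (p - Suc i) * y ^ i) = int p * y ^ (p - 1)"
    by (simp add: power_add[symmetric])
  also have "[int p * y ^ (p - 1) = 0] (mod int p)" by (simp add: cong_0_iff)
  finally have "int p dvd (\<Sum>i<p. y ^ (p - Suc i) * x ^ i)" by (simp add: cong_0_iff)
  moreover have "int p ^ k dvd x - y" using assms(1) by (simp add: cong_iff_dvd_diff)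
  ultimately have "int p ^ k * int p dvd (x - y) * (\<Sum>i<p. y ^ (p - Suc i) * x ^ i)"
    by (intro mult_dvd_mono)
  then show ?thesis
    by (simp add: cong_iff_dvd_diff power_diff_sumr2 mult.commute)
qed

section \<open>The factorial without multiples of \<open>p\<close>, and Wilson's theorem for prime
  powers\<close>

text \<open>Multiples of \<open>p\<close> get the value 1 instead of being left out, so that
  products run over whole intervals and can be cut into blocks.\<close>

definition unit_part :: "nat \<Rightarrow> nat \<Rightarrow> int" where
  "unit_part p j = (if p dvd j then 1 else int j)"

text \<open>Up to the sign \<open>(- 1) ^ N\<close>, this is Morita's function at a positive integer
  \<open>N\<close>.\<close>

definition unit_fact :: "nat \<Rightarrow> nat \<Rightarrow> int" where
  "unit_fact p N = (\<Prod>j<N. unit_part p j)"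

lemma prod_unit_part: "finite A \<Longrightarrow> (\<Prod>j\<in>A. unit_part p j) = (\<Prod>j\<in>{j\<in>A. \<not> p dvd j}. int j)"
  by (rule prod.mono_neutral_cong_right) (auto simp: unit_part_def)

lemma unit_part_add_cong:
  assumes "p dvd q"
  shows "[unit_part p (j + q) = unit_part p j] (mod int q)"
  using assms by (auto simp: unit_part_def cong_iff_dvd_diff dvd_add_left_iff)

text \<open>Induction from Wilson's theorem: below \<open>p ^ Suc k\<close> lie \<open>p\<close>
  blocks of length \<open>q = p ^ k\<close>, all with the same product modulo
  \<open>q\<^sup>2\<close> by reflection, and the \<open>p\<close>-th power of a number congruent to
  -1 modulo \<open>p ^ k\<close> gains one power of \<open>p\<close>.\<close>

lemma unit_fact_prime_power:
  assumes p: "prime p" "odd p" and "k \<ge> 1"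
  shows "[unit_fact p (p ^ k) = - 1] (mod int p ^ k)"
  using \<open>k \<ge> 1\<close>
proof (induction k rule: nat_induct_at_least)
  case base
  have "{..<p} = insert 0 {1..p - 1}" using prime_gt_0_nat[OF p(1)] by auto
  then have "unit_fact p p = (\<Prod>j = 1..p - 1. unit_part p j)"
    by (simp add: unit_fact_def unit_part_def)
  also have "\<dots> = (\<Prod>j = 1..p - 1. int j)"
    by (rule prod.cong) (auto simp: unit_part_def dest: dvd_imp_le)
  finally have "unit_fact p p = fact (p - 1)" by (simp add: fact_prod)
  then show ?case using wilson_theorem[OF p(1)] by simp
next
  case (Suc k)
  define q where "q = p ^ k"
  have q: "q > 0" "p dvd q" using p(1) Suc.hyps by (auto simp: q_def prime_gt_0_nat)
  define A where "A = {j\<in>{..<q}. \<not> p dvd j}"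
  have reflect: "p dvd q - j \<longleftrightarrow> p dvd j" if "j \<le> q" for j
    using q(2) that dvd_diffD1[of p q j] dvd_diff_nat[of p q j] by blast
  \<comment> \<open>The reflection pairs the indices below \<open>q / 2\<close> with those above; as
    \<open>q\<close> is odd, none is its own partner.\<close>
  have cA: "even (card A)"
  proof -
    have "bij_betw (\<lambda>j. q - j) {j\<in>A. 2 * j < q} {j\<in>A. 2 * j > q}"
      by (rule bij_betw_byWitness[where f' = "\<lambda>j. q - j"])
        (use reflect q in \<open>auto simp: A_def less_imp_le intro!: diff_less Nat.gr0I\<close>)
    then have "card {j\<in>A. 2 * j < q} = card {j\<in>A. 2 * j > q}" by (rule bij_betw_same_card)
    moreover have "odd q" using p(2) by (simp add: q_def)
    then have "2 * j < q \<or> 2 * j > q" for j by presburger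
    then have "A = {j\<in>A. 2 * j < q} \<union> {j\<in>A. 2 * j > q}" by blast
    then have "card A = card ({j\<in>A. 2 * j < q} \<union> {j\<in>A. 2 * j > q})" by (rule arg_cong)
    moreover have "\<dots> = card {j\<in>A. 2 * j < q} + card {j\<in>A. 2 * j > q}"
      by (rule card_Un_disjoint) (auto simp: A_def)
    ultimately show ?thesis by simp
  qed
  have block: "[(\<Prod>j = c * q..<c * q + q. unit_part p j) = unit_fact p q] (mod (int q)\<^sup>2)" for c
  proof -
    have "(\<Prod>j = c * q..<c * q + q. unit_part p j) = (\<Prod>j<q. unit_part p (c * q + j))"
      by (rule prod.reindex_bij_witness[where i = "\<lambda>j. c * q + j" and j = "\<lambda>j. j - c * q"]) auto
    also have "\<dots> = (\<Prod>j\<in>A. int c * int q + int j)"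
      using q(2) by (intro prod.mono_neutral_cong_right) (auto simp: A_def unit_part_def dvd_add_right_iff)
    also have "[\<dots> = (\<Prod>j\<in>A. int j)] (mod (int q)\<^sup>2)"
    proof (rule prod_shift_cong[OF _ cA q(1)])
      fix j assume "j \<in> A"
      moreover from this have "j > 0" by (auto simp: A_def intro!: Nat.gr0I)
      ultimately show "j \<le> q \<and> q - j \<in> A"
        using reflect by (auto simp: A_def)
    qed (simp add: A_def)
    finally show ?thesis by (simp add: unit_fact_def prod_unit_part A_def)
  qed
  have "unit_fact p (p ^ Suc k) = (\<Prod>c<p. \<Prod>j = c * q..<c * q + q. unit_part p j)"
    by (simp add: unit_fact_def q_def prod.nat_group)
  also have "[\<dots> = (\<Prod>c<p. unit_fact p q)] (mod (int q)\<^sup>2)"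
    by (intro cong_prod block)
  finally have "[unit_fact p (p ^ Suc k) = unit_fact p q ^ p] (mod (int q)\<^sup>2)" by simp
  \<comment> \<open>Here \<open>k \<ge> 1\<close> enters, in the form
    \<open>Suc k \<le> 2 * k\<close>.\<close>
  moreover have "int p ^ Suc k dvd (int q)\<^sup>2"
    unfolding q_def of_nat_power power_mult[symmetric] using Suc.hyps by (intro le_imp_power_dvd) simp
  ultimately have "[unit_fact p (p ^ Suc k) = unit_fact p q ^ p] (mod int p ^ Suc k)"
    using cong_dvd_modulus by blast
  also have "[unit_fact p q ^ p = (- 1) ^ p] (mod int p ^ Suc k)"
    using Suc unfolding q_def by (intro cong_pow_prime_lift) auto
  finally show ?case using p(2) by simp
qed

lemma unit_fact_add_prime_power:
  assumes p: "prime p" "odd p" and "k \<ge> 1"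
  shows "[unit_fact p (N + p ^ k) = - unit_fact p N] (mod int p ^ k)"
proof (induction N)
  case 0
  then show ?case using unit_fact_prime_power[OF assms] by (simp add: unit_fact_def)
next
  case (Suc N)
  have "[unit_part p (N + p ^ k) = unit_part p N] (mod int p ^ k)"
    using unit_part_add_cong[of p "p ^ k" N] assms by simp
  from cong_mult[OF Suc this] show ?case
    by (simp add: unit_fact_def)
qed

text \<open>As \<open>p ^ k\<close> is odd, a shift by it reverses both the sign factor and
  \<open>unit_fact\<close>, so their product is periodic modulo \<open>p ^ k\<close>. This is the
  continuity that makes Morita's limit exist.\<close>

lemma unit_fact_sign_cong:
  assumes p: "prime p" "odd p" and "k \<ge> 1" and "[M = N] (mod p ^ k)"
  shows "[(- 1) ^ M * unit_fact p M = (- 1) ^ N * unit_fact p N] (mod int p ^ k)"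
proof -
  have *: "[(- 1) ^ (N + c * p ^ k) * unit_fact p (N + c * p ^ k) = (- 1) ^ N * unit_fact p N] (mod int p ^ k)"
    for N c
  proof (induction c)
    case (Suc c)
    let ?M = "N + c * p ^ k"
    have "[unit_fact p (?M + p ^ k) = - unit_fact p ?M] (mod int p ^ k)"
      by (rule unit_fact_add_prime_power) (use assms in auto)
    from cong_scalar_left[OF this, of "(- 1) ^ (?M + p ^ k)"]
    have "[(- 1) ^ (?M + p ^ k) * unit_fact p (?M + p ^ k) = (- 1) ^ ?M * unit_fact p ?M] (mod int p ^ k)"
      using p(2) by (simp add: power_add)
    from cong_trans[OF this Suc] show ?case by (simp add: add_ac)
  qed simp
  \<comment> \<open>Either of \<open>M\<close> and \<open>N\<close> may be the larger one, so both
    are moved up to a common value.\<close>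
  obtain c d where cd: "N + c * p ^ k = M + d * p ^ k"
    using assms(4) unfolding cong_iff_lin_nat by blast
  show ?thesis by (rule cong_trans[OF cong_sym[OF *[of M d]] *[of N c, unfolded cd]])
qed

section \<open>Rising factorial polynomials and shifted factorials modulo
  \<open>p\<^sup>2\<close>\<close>

definition rising_poly :: "nat \<Rightarrow> int poly" where
  "rising_poly m = (\<Prod>l = 1..m. [:int l, 1:])"

lemma poly_rising_poly: "poly (rising_poly m) x = (\<Prod>l = 1..m. x + int l)"
  by (simp add: rising_poly_def poly_prod add.commute)

lemma poly_rising_poly_0: "poly (rising_poly m) 0 = fact m"
  by (simp add: poly_rising_poly fact_prod)

lemma lead_coeff_rising_poly: "lead_coeff (rising_poly m) = 1"
  by (simp add: rising_poly_def lead_coeff_prod)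

lemma degree_rising_poly: "degree (rising_poly m) = m"
  by (simp add: rising_poly_def degree_prod_eq_sum_degree)

text \<open>The product is cut after its first \<open>s\<close> factors. Value and derivative at 0
  yield the two identities below, which relate behaviour at 0 to behaviour at
  \<open>s\<close>.\<close>

lemma rising_poly_add:
  "rising_poly (s + k) = rising_poly s * pcompose (rising_poly k) [:int s, 1:]"
proof (induction k)
  case 0
  then show ?case by (simp add: rising_poly_def)
next
  case (Suc k)
  have "rising_poly (Suc m) = rising_poly m * [:int (Suc m), 1:]" for m
    by (simp add: rising_poly_def)
  with Suc show ?case
    by (simp only: add_Suc_right pcompose_mult mult.assoc) (simp add: pcompose_pCons add_ac)
qed

lemma fact_mult_poly_rising_poly: "fact s * poly (rising_poly k) (int s) = fact (s + k)"
  using arg_cong[OF rising_poly_add[of s k], of "\<lambda>q. poly q 0"]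
  by (simp add: poly_rising_poly_0 poly_pcompose)

text \<open>Product rule for the split polynomial at 0. In harmonic numbers,
  \<open>rising_poly k\<close> has logarithmic derivative \<open>H (s + k) - H s\<close> at
  \<open>s\<close>; multiplying by factorials avoids fractions.\<close>

lemma fact_mult_pderiv_rising_poly:
  "fact s * poly (pderiv (rising_poly (s + k))) 0
     = fact (s + k) * poly (pderiv (rising_poly s)) 0
       + (fact s)\<^sup>2 * poly (pderiv (rising_poly k)) (int s)"
proof -
  have "poly (pderiv (rising_poly (s + k))) 0
      = fact s * poly (pderiv (rising_poly k)) (int s)
        + poly (rising_poly k) (int s) * poly (pderiv (rising_poly s)) 0"
    by (simp add: rising_poly_add pderiv_mult poly_rising_poly_0 poly_pcompose pderiv_pcompose
        pderiv_pCons)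
  then show ?thesis
    unfolding fact_mult_poly_rising_poly[of s k, symmetric]
    by (simp only:) (simp add: algebra_simps power2_eq_square)
qed

text \<open>
  Up to a power of \<open>(p - 1)!\<close>, these are the values of \<open>\<Gamma>\<^sub>p\<close> modulo \<open>p\<^sup>2\<close> at the fractions with
  denominator \<open>p - 1\<close>.
\<close>

definition shifted_fact :: "nat \<Rightarrow> nat \<Rightarrow> int" where
  "shifted_fact p m = poly (rising_poly m) (int m * int p)"

lemma shifted_fact_cong:
  "[shifted_fact p m = fact m + int m * int p * poly (pderiv (rising_poly m)) 0] (mod (int p)\<^sup>2)"
  using poly_add_cong[of "rising_poly m" 0 "int m * int p"]
  by (auto intro: cong_dvd_modulus simp: shifted_fact_def poly_rising_poly_0 power_mult_distrib)

lemma shifted_fact_cong_fact: "[shifted_fact p m = fact m] (mod int p)"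
proof -
  have "[shifted_fact p m = fact m + int m * int p * poly (pderiv (rising_poly m)) 0] (mod int p)"
    using shifted_fact_cong by (rule cong_dvd_modulus) simp
  also have "[fact m + int m * int p * poly (pderiv (rising_poly m)) 0 = fact m] (mod int p)"
    by (simp add: cong_iff_dvd_diff)
  finally show ?thesis .
qed

lemma cong_add_mult_mult:
  fixes a b c d x :: int
  shows "[(a + x * b) * (c + x * d) = a * c + x * (a * d + b * c)] (mod x\<^sup>2)"
proof -
  have "(a + x * b) * (c + x * d) - (a * c + x * (a * d + b * c)) = x\<^sup>2 * (b * d)"
    by (simp add: algebra_simps power2_eq_square)
  then show ?thesis by (simp add: cong_iff_dvd_diff)
qed

text \<open>
  Writing \<open>H m\<close> for the harmonic numbers, \<open>shifted_fact p m \<equiv> m! (1 + p m H m)\<close>; the bracket on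
  the right is \<open>(s + k)! (1 + p s (H (s + k) - H s) + p k (H (s + k) - H k))\<close>.
\<close>

lemma shifted_fact_add:
  "[fact k * fact s * shifted_fact p (s + k)
    = shifted_fact p k * shifted_fact p s
      * (fact s * poly (rising_poly k) (int s + int p * int s)
         + int p * (int k * fact k * poly (pderiv (rising_poly s)) (int k)))] (mod (int p)\<^sup>2)"
proof -
  let ?e = "\<lambda>m. poly (pderiv (rising_poly m)) 0"
  define x where "x = int p"
  define a b c where "a = ?e s" and "b = ?e k" and "c = ?e (s + k)"
  define t u where "t = poly (pderiv (rising_poly k)) (int s)"
    and "u = poly (pderiv (rising_poly s)) (int k)"
  have V: "[shifted_fact p m = fact m + x * (int m * ?e m)] (mod x\<^sup>2)" for m
    using shifted_fact_cong[of p m] by (simp add: x_def mult_ac)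
  have "[poly (rising_poly k) (int s + x * int s)
      = poly (rising_poly k) (int s) + x * int s * t] (mod x\<^sup>2)"
    using poly_add_cong[of "rising_poly k" "int s" "x * int s"]
    by (auto intro: cong_dvd_modulus simp: power_mult_distrib t_def)
  from cong_scalar_left[OF this, of "fact s"]
  have F: "[fact s * poly (rising_poly k) (int s + x * int s)
      = fact (s + k) + x * (int s * fact s * t)] (mod x\<^sup>2)"
    by (simp add: distrib_left fact_mult_poly_rising_poly mult_ac)
  \<comment> \<open>The sum is split once at \<open>s\<close> and once at \<open>k\<close>; weighted
    by \<open>s\<close> and \<open>k\<close>, the two identities later add up to the term
    \<open>int (s + k) * c\<close>.\<close>
  have st: "fact s * c = fact (s + k) * a + (fact s)\<^sup>2 * t"
    unfolding a_def c_def t_def by (rule fact_mult_pderiv_rising_poly)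
  have ku: "fact k * c = fact (s + k) * b + (fact k)\<^sup>2 * u"
    unfolding b_def c_def u_def using fact_mult_pderiv_rising_poly[of k s] by (simp add: add.commute)
  let ?B = "fact s * poly (rising_poly k) (int s + x * int s) + x * (int k * fact k * u)"
  have B: "[?B = fact (s + k) + x * (int s * fact s * t + int k * fact k * u)] (mod x\<^sup>2)"
    using cong_add[OF F cong_refl[of "x * (int k * fact k * u)"]] by (simp add: algebra_simps)
  have "[shifted_fact p k * shifted_fact p s = (fact k + x * (int k * b)) * (fact s + x * (int s * a))]
      (mod x\<^sup>2)"
    unfolding a_def b_def by (intro cong_mult V)
  also have "[(fact k + x * (int k * b)) * (fact s + x * (int s * a))
      = fact k * fact s + x * (fact k * (int s * a) + int k * b * fact s)] (mod x\<^sup>2)"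
    by (rule cong_add_mult_mult)
  finally have "[shifted_fact p k * shifted_fact p s * ?B
      = (fact k * fact s + x * (fact k * (int s * a) + int k * b * fact s))
        * (fact (s + k) + x * (int s * fact s * t + int k * fact k * u))] (mod x\<^sup>2)"
    using B by (rule cong_mult)
  also have "[(fact k * fact s + x * (fact k * (int s * a) + int k * b * fact s))
        * (fact (s + k) + x * (int s * fact s * t + int k * fact k * u))
      = fact k * fact s * fact (s + k)
        + x * (fact k * fact s * (int s * fact s * t + int k * fact k * u)
               + (fact k * (int s * a) + int k * b * fact s) * fact (s + k))] (mod x\<^sup>2)"
    by (rule cong_add_mult_mult)
  also have "fact k * fact s * (int s * fact s * t + int k * fact k * u)
               + (fact k * (int s * a) + int k * b * fact s) * fact (s + k)
      = fact k * int s * (fact (s + k) * a + (fact s)\<^sup>2 * t)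
        + fact s * int k * (fact (s + k) * b + (fact k)\<^sup>2 * u)"
    by (simp add: algebra_simps power2_eq_square)
  also have "\<dots> = fact k * fact s * (int (s + k) * c)"
    unfolding st[symmetric] ku[symmetric] by (simp add: algebra_simps)
  also have "fact k * fact s * fact (s + k) + x * (fact k * fact s * (int (s + k) * c))
      = fact k * fact s * (fact (s + k) + x * (int (s + k) * c))"
    by (simp add: algebra_simps)
  also have "[\<dots> = fact k * fact s * shifted_fact p (s + k)] (mod x\<^sup>2)"
    unfolding c_def by (intro cong_mult cong_refl cong_sym[OF V])
  finally show ?thesis
    unfolding x_def u_def by (rule cong_sym)
qed

text \<open>Modulo \<open>p\<^sup>2\<close> the shift \<open>(p - 1 - k) p\<close> is congruent to
  \<open>- (k + 1) p\<close>. Under \<open>l \<mapsto> p - l\<close> the factors of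
  \<open>shifted_fact p k\<close> become, up to sign, the last \<open>k\<close> factors of the block
  with that shift, so both together fill the block.\<close>

lemma shifted_fact_reflect:
  assumes p: "prime p" "odd p" and k: "k \<le> p - 1"
  shows "[(- 1) ^ k * shifted_fact p (p - 1 - k) * shifted_fact p k = fact (p - 1)] (mod (int p)\<^sup>2)"
proof -
  let ?c = "- int (Suc k)"
  have p0: "p > 0" using p(1) by (simp add: prime_gt_0_nat)
  have 1: "[shifted_fact p (p - 1 - k) = (\<Prod>l = 1..p - 1 - k. ?c * int p + int l)] (mod (int p)\<^sup>2)"
    unfolding shifted_fact_def poly_rising_poly
  proof (intro cong_prod)
    fix l
    have "int (p - 1 - k) = int p + ?c" using k p0 by (simp add: of_nat_diff)
    then have "int (p - 1 - k) * int p + int l - (?c * int p + int l) = (int p)\<^sup>2"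
      by (simp add: algebra_simps power2_eq_square)
    then show "[int (p - 1 - k) * int p + int l = ?c * int p + int l] (mod (int p)\<^sup>2)"
      by (simp add: cong_iff_dvd_diff)
  qed
  have 2: "(- 1) ^ k * shifted_fact p k = (\<Prod>l = p - k..p - 1. ?c * int p + int l)"
  proof -
    have "(\<Prod>l = p - k..p - 1. ?c * int p + int l) = (\<Prod>l = 1..k. ?c * int p + int (p - l))"
      by (rule prod.reindex_bij_witness[where i = "\<lambda>l. p - l" and j = "\<lambda>l. p - l"])
        (use k p0 in auto)
    also have "\<dots> = (\<Prod>l = 1..k. - (int k * int p + int l))"
      by (rule prod.cong) (use k p0 in \<open>auto simp: of_nat_diff algebra_simps\<close>)
    finally show ?thesis
      unfolding prod_uminus shifted_fact_def poly_rising_poly by simp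
  qed
  have "(- 1) ^ k * shifted_fact p (p - 1 - k) * shifted_fact p k
      = shifted_fact p (p - 1 - k) * ((- 1) ^ k * shifted_fact p k)" by simp
  also have "[\<dots> = (\<Prod>l = 1..p - 1 - k. ?c * int p + int l) * (\<Prod>l = p - k..p - 1. ?c * int p + int l)]
      (mod (int p)\<^sup>2)"
    unfolding 2 by (intro cong_mult 1 cong_refl)
  also have "(\<Prod>l = 1..p - 1 - k. ?c * int p + int l) * (\<Prod>l = p - k..p - 1. ?c * int p + int l)
      = (\<Prod>l = 1..p - 1. ?c * int p + int l)"
  proof -
    have "{1..p - 1} = {1..p - 1 - k} \<union> {p - k..p - 1}" using k p0 by auto
    moreover have "{1..p - 1 - k} \<inter> {p - k..p - 1} = {}" by auto
    ultimately show ?thesis by (simp add: prod.union_disjoint)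
  qed
  also have "[\<dots> = fact (p - 1)] (mod (int p)\<^sup>2)" by (rule prod_block_cong[OF p])
  finally show ?thesis .
qed

text \<open>The factor at \<open>l = p\<close> is \<open>(m + 1) p\<close>. Modulo \<open>p\<close>,
  the factors before it give -1 by Wilson's theorem, those after it give \<open>(m - p)!\<close>,
  and \<open>m + 1\<close> completes the latter to \<open>(m - p + 1)!\<close>. This serves the
  terms of \<open>G\<close> with an extra \<open>-p\<close>.\<close>

lemma shifted_fact_ge:
  assumes p: "prime p" and m: "p \<le> m"
  shows "\<exists>z. shifted_fact p m = int p * z
           \<and> (m < 2 * p \<longrightarrow> [z = - shifted_fact p (m - (p - 1))] (mod int p))"
proof -
  have p0: "p > 0" using p by (simp add: prime_gt_0_nat)
  define z where "z = (1 + int m) * ((\<Prod>l = 1..p - 1. int m * int p + int l)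
    * (\<Prod>l = p + 1..m. int m * int p + int l))"
  have "{1..m} = insert p ({1..p - 1} \<union> {p + 1..m})" using m p0 by auto
  moreover have "{1..p - 1} \<inter> {p + 1..m} = {}" "p \<notin> {1..p - 1} \<union> {p + 1..m}" by auto
  ultimately have "(\<Prod>l = 1..m. int m * int p + int l)
      = (int m * int p + int p) * ((\<Prod>l = 1..p - 1. int m * int p + int l)
        * (\<Prod>l = p + 1..m. int m * int p + int l))"
    by (simp add: prod.union_disjoint)
  then have "shifted_fact p m = int p * z"
    by (simp add: shifted_fact_def poly_rising_poly z_def algebra_simps)
  moreover have "[z = - shifted_fact p (m - (p - 1))] (mod int p)" if "m < 2 * p"
  proof -
    have "[(\<Prod>l = 1..p - 1. int m * int p + int l) = (\<Prod>l = 1..p - 1. int l)] (mod int p)"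
      by (intro cong_prod) (simp add: cong_iff_dvd_diff)
    also have "(\<Prod>l = 1..p - 1. int l) = fact (p - 1)" by (simp add: fact_prod)
    also have "[fact (p - 1) = - 1] (mod int p)" by (rule wilson_theorem[OF p])
    finally have 1: "[(\<Prod>l = 1..p - 1. int m * int p + int l) = - 1] (mod int p)" .
    have "(\<Prod>l = p + 1..m. int m * int p + int l) = (\<Prod>l = 1..m - p. int m * int p + int (p + l))"
      by (rule prod.reindex_bij_witness[where i = "\<lambda>l. p + l" and j = "\<lambda>l. l - p"]) auto
    also have "[\<dots> = (\<Prod>l = 1..m - p. int l)] (mod int p)"
      by (intro cong_prod) (simp add: cong_iff_dvd_diff)
    finally have 2: "[(\<Prod>l = p + 1..m. int m * int p + int l) = fact (m - p)] (mod int p)"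
      by (simp add: fact_prod)
    have 3: "[1 + int m = int (m - p + 1)] (mod int p)"
      using m by (simp add: cong_iff_dvd_diff of_nat_diff)
    have "[z = int (m - p + 1) * (- 1 * fact (m - p))] (mod int p)"
      unfolding z_def by (intro cong_mult 1 2 3)
    also have "int (m - p + 1) * (- 1 * fact (m - p)) = - fact (m - (p - 1))"
    proof -
      have "m - (p - 1) = Suc (m - p)" using m p0 by simp
      then show ?thesis by (simp only: fact_Suc) simp
    qed
    also have "[- fact (m - (p - 1)) = - shifted_fact p (m - (p - 1))] (mod int p)"
      using cong_sym[OF shifted_fact_cong_fact[of p "m - (p - 1)"]] by (simp add: cong_minus_minus_iff)
    finally show ?thesis .
  qed
  ultimately show ?thesis by blast
qed

lemma coprime_fact_prime:
  assumes "prime p" "m < p"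
  shows "coprime (fact m :: int) (int p)"
  using assms prime_dvd_fact_iff[of p m]
  by (metis coprime_commute coprime_int_iff not_le of_nat_fact prime_imp_coprime)

lemma coprime_shifted_fact:
  assumes "prime p" "m < p"
  shows "coprime (shifted_fact p m) (int p)"
  using coprime_fact_prime[OF assms] shifted_fact_cong_fact cong_imp_coprime cong_sym by blast

text \<open>The indices up to \<open>s * p + s\<close> form \<open>s\<close> full blocks, each
  contributing \<open>(p - 1)!\<close>, and one broken block whose entries other than
  \<open>s * p\<close> are the factors of \<open>shifted_fact p s\<close>.\<close>

lemma unit_fact_shifted_fact:
  assumes p: "prime p" "odd p" and s: "s < p"
  shows "[unit_fact p (s * p + s + 1) = fact (p - 1) ^ s * shifted_fact p s] (mod (int p)\<^sup>2)"
proof -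
  have p0: "p > 0" using p(1) by (simp add: prime_gt_0_nat)
  have nd: "\<not> p dvd j" if "0 < j" "j < p" for j using that by (auto dest: dvd_imp_le)
  \<comment> \<open>\<open>i = p - 1\<close> gives a full block and \<open>i = s\<close> the broken
    one; the entry at \<open>c * p\<close> counts as 1.\<close>
  have block: "(\<Prod>j = c * p..<c * p + Suc i. unit_part p j) = (\<Prod>l = 1..i. int c * int p + int l)"
    if "i < p" for c i
  proof -
    have "(\<Prod>j = c * p..<c * p + Suc i. unit_part p j) = (\<Prod>l\<in>{..i}. unit_part p (c * p + l))"
      by (rule prod.reindex_bij_witness[where i = "\<lambda>l. c * p + l" and j = "\<lambda>l. l - c * p"]) auto
    also have "\<dots> = (\<Prod>l\<in>{1..i}. int c * int p + int l)"
      using that nd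
      by (intro prod.mono_neutral_cong_right) (auto simp: unit_part_def not_less_eq_eq)
    finally show ?thesis .
  qed
  have "unit_fact p (s * p + s + 1)
      = (\<Prod>j<s * p. unit_part p j) * (\<Prod>j = s * p..<s * p + Suc s. unit_part p j)"
    unfolding unit_fact_def
    by (subst prod.atLeastLessThan_concat[of 0 "s * p", symmetric, simplified atLeast0LessThan]) auto
  also have "(\<Prod>j<s * p. unit_part p j) = (\<Prod>c<s. \<Prod>j = c * p..<c * p + p. unit_part p j)"
    by (simp add: prod.nat_group)
  also have "\<dots> = (\<Prod>c<s. \<Prod>l = 1..p - 1. int c * int p + int l)"
    by (rule prod.cong[OF refl]) (use block[of "p - 1"] p0 in simp)
  also have "(\<Prod>j = s * p..<s * p + Suc s. unit_part p j) = shifted_fact p s"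
    using block[OF s] by (simp add: shifted_fact_def poly_rising_poly)
  also have "[(\<Prod>c<s. \<Prod>l = 1..p - 1. int c * int p + int l) * shifted_fact p s
      = (\<Prod>c<s. fact (p - 1)) * shifted_fact p s] (mod (int p)\<^sup>2)"
    by (intro cong_mult cong_prod prod_block_cong p cong_refl)
  finally show ?thesis by simp
qed

section \<open>Power sums modulo \<open>p\<close>\<close>

text \<open>Telescoping \<open>(k + 1) ^ Suc e - k ^ Suc e\<close> expresses \<open>Suc e\<close>
  times the sum through \<open>p ^ Suc e\<close> and lower power sums, and \<open>Suc e < p\<close>
  can be cancelled.\<close>

lemma sum_power_cong_0:
  assumes "prime p" "e < p - 1"
  shows "int p dvd (\<Sum>k<p. int k ^ e)"
  using assms(2)
proof (induction e rule: less_induct)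
  case (less e)
  have tele: "(\<Sum>k<p. (int k + 1) ^ Suc e - int k ^ Suc e) = int p ^ Suc e"
    using sum_lessThan_telescope[of "\<lambda>k. int k ^ Suc e" p] by (simp add: add.commute)
  have expand: "(x + 1) ^ Suc e - x ^ Suc e
      = (\<Sum>i<e. int (Suc e choose i) * x ^ i) + int (Suc e) * x ^ e" for x :: int
  proof -
    have "(x + 1) ^ Suc e = (\<Sum>i\<le>Suc e. int (Suc e choose i) * x ^ i)"
      by (subst binomial_ring) simp
    also have "{..Suc e} = insert (Suc e) (insert e {..<e})" by auto
    also have "(\<Sum>i\<in>\<dots>. int (Suc e choose i) * x ^ i)
        = x ^ Suc e + (int (Suc e) * x ^ e + (\<Sum>i<e. int (Suc e choose i) * x ^ i))"
      by (subst sum.insert, simp, simp)+ (simp only: binomial_n_n binomial_Suc_n of_nat_1 mult_1)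
    finally show ?thesis by simp
  qed
  have "int p ^ Suc e = (\<Sum>k<p. \<Sum>i<e. int (Suc e choose i) * int k ^ i)
      + int (Suc e) * (\<Sum>k<p. int k ^ e)"
    unfolding tele[symmetric] expand by (simp only: sum.distrib sum_distrib_left)
  also have "(\<Sum>k<p. \<Sum>i<e. int (Suc e choose i) * int k ^ i)
      = (\<Sum>i<e. int (Suc e choose i) * (\<Sum>k<p. int k ^ i))"
    by (subst sum.swap) (simp add: sum_distrib_left)
  finally have eq: "int (Suc e) * (\<Sum>k<p. int k ^ e)
      = int p ^ Suc e - (\<Sum>i<e. int (Suc e choose i) * (\<Sum>k<p. int k ^ i))" by simp
  have "int p dvd (\<Sum>i<e. int (Suc e choose i) * (\<Sum>k<p. int k ^ i))"
    by (rule dvd_sum, rule dvd_mult, rule less.IH) (use less.prems in auto)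
  then have "int p dvd int (Suc e) * (\<Sum>k<p. int k ^ e)"
    unfolding eq by (intro dvd_diff) auto
  moreover have "\<not> int p dvd int (Suc e)"
    using less.prems by (metis Suc_lessI dvd_imp_le int_dvd_int_iff less_diff_conv not_less plus_1_eq_Suc add.commute zero_less_Suc)
  ultimately show ?case
    using assms(1) by (simp add: prime_dvd_mult_iff)
qed

lemma fermat_theorem_int:
  assumes "prime p" "\<not> p dvd k"
  shows "[int k ^ (p - 1) = 1] (mod int p)"
  using fermat_theorem[OF assms] cong_int_iff[of "k ^ (p - 1)" 1 p] by simp

lemma power_prime_cong:
  assumes "prime p" "e > 0"
  shows "[int k ^ (e + (p - 1)) = int k ^ e] (mod int p)"
proof (cases "p dvd k")
  case True
  then have "[int k = 0] (mod int p)" by (simp add: cong_0_iff)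
  then have "[int k ^ i = 0 ^ i] (mod int p)" for i by (rule cong_pow)
  from this[of e] this[of "e + (p - 1)"] show ?thesis
    using assms(2) by (simp add: zero_power) (metis cong_sym cong_trans)
next
  case False
  from cong_scalar_left[OF fermat_theorem_int[OF assms(1) this], of "int k ^ e"] show ?thesis by (simp add: power_add)
qed

text \<open>The weight \<open>Suc e\<close> comes from differentiating \<open>X ^ Suc e\<close>. At
  \<open>e = p - 1\<close> the power sum does not vanish, but the weight is \<open>p\<close>; at
  \<open>e = 2 * (p - 1)\<close> sum and weight are both -1; for all other \<open>e\<close> the sum
  vanishes.\<close>

lemma sum_power_weighted_cong:
  assumes p: "prime p" and e: "e \<le> 2 * (p - 1)"
  shows "[int (Suc e) * (\<Sum>k<p. int k ^ e) = (if e = 2 * (p - 1) then 1 else 0)] (mod int p)"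
proof -
  have p2: "p \<ge> 2" using p by (rule prime_ge_2_nat)
  have red: "[(\<Sum>k<p. int k ^ (i + (p - 1))) = (\<Sum>k<p. int k ^ i)] (mod int p)" if "i > 0" for i
    using p that by (intro cong_sum power_prime_cong)
  consider "e < p - 1" | "e = p - 1" | "p - 1 < e" "e < 2 * (p - 1)" | "e = 2 * (p - 1)"
    using e by linarith
  then show ?thesis
  proof cases
    case 1
    then show ?thesis using sum_power_cong_0[OF p] by (auto simp: cong_0_iff)
  next
    case 2
    then have "int (Suc e) = int p" "e \<noteq> 2 * (p - 1)" using p2 by auto
    then show ?thesis by (simp add: cong_0_iff)
  next
    case 3
    then have "[(\<Sum>k<p. int k ^ e) = (\<Sum>k<p. int k ^ (e - (p - 1)))] (mod int p)"
      using red[of "e - (p - 1)"] by simp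
    moreover have "[(\<Sum>k<p. int k ^ (e - (p - 1))) = 0] (mod int p)"
      using sum_power_cong_0[OF p, of "e - (p - 1)"] 3 by (simp add: cong_0_iff)
    ultimately have "int p dvd (\<Sum>k<p. int k ^ e)"
      using cong_trans cong_0_iff by blast
    then show ?thesis using 3 by (simp add: cong_0_iff)
  next
    case 4
    have "[(\<Sum>k<p. int k ^ e) = (\<Sum>k<p. int k ^ (p - 1))] (mod int p)"
      using red[of "p - 1"] p2 4 by (simp add: mult_2)
    also have "(\<Sum>k<p. int k ^ (p - 1)) = (\<Sum>k = 1..<p. int k ^ (p - 1))"
      using p2 by (intro sum.mono_neutral_right) (auto simp: zero_power)
    also have "[\<dots> = (\<Sum>k = 1..<p. 1)] (mod int p)"
    proof (rule cong_sum)
      fix k assume "k \<in> {1..<p}"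
      then have "\<not> p dvd k" by (auto dest: dvd_imp_le)
      then show "[int k ^ (p - 1) = 1] (mod int p)"
        by (rule fermat_theorem_int[OF p])
    qed
    also have "(\<Sum>k = 1..<p. 1) = int p - 1" using p2 by (simp add: of_nat_diff)
    finally have "[int (Suc e) * (\<Sum>k<p. int k ^ e) = int (Suc e) * (int p - 1)] (mod int p)"
      by (rule cong_scalar_left)
    also have e': "int (Suc e) = 2 * int p - 1" using 4 p2 by (simp add: of_nat_diff)
    also have "[(2 * int p - 1) * (int p - 1) = 1] (mod int p)"
    proof -
      have "(2 * int p - 1) * (int p - 1) - 1 = int p * (2 * int p - 3)"
        by (simp add: algebra_simps)
      then show ?thesis by (simp add: cong_iff_dvd_diff)
    qed
    finally show ?thesis unfolding e' using 4 by simp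
  qed
qed

text \<open>The summand is the derivative of \<open>X P\<close> at \<open>k\<close>, so a
  coefficient of degree \<open>e\<close> meets the power sum with weight \<open>Suc e\<close>, and
  only the top degree survives.\<close>

lemma sum_pderiv_cong:
  fixes P :: "int poly"
  assumes p: "prime p" and deg: "degree P \<le> 2 * (p - 1)"
  shows "[(\<Sum>k<p. poly P (int k) + int k * poly (pderiv P) (int k)) = coeff P (2 * (p - 1))] (mod int p)"
proof -
  let ?D = "2 * (p - 1)"
  have P: "poly P x = (\<Sum>i\<le>?D. coeff P i * x ^ i)" for x
    unfolding poly_altdef
    by (rule sum.mono_neutral_left) (use deg in \<open>auto simp: coeff_eq_0\<close>)
  have P': "x * poly (pderiv P) x = (\<Sum>i\<le>?D. int i * coeff P i * x ^ i)" for x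
  proof -
    have "P = (\<Sum>i\<le>?D. monom (coeff P i) i)"
      using deg by (simp add: poly_as_sum_of_monoms')
    then have "pderiv P = (\<Sum>i\<le>?D. pderiv (monom (coeff P i) i))"
      using pderiv_sum by metis
    then have "x * poly (pderiv P) x = (\<Sum>i\<le>?D. x * (int i * coeff P i * x ^ (i - 1)))"
      by (simp add: pderiv_monom poly_sum poly_monom sum_distrib_left)
    \<comment> \<open>The truncated exponent \<open>i - 1\<close> is harmless at
      \<open>i = 0\<close>, where the factor \<open>int i\<close> is 0.\<close>
    also have "\<dots> = (\<Sum>i\<le>?D. int i * coeff P i * x ^ i)"
      by (rule sum.cong[OF refl]) (simp add: power_eq_if)
    finally show ?thesis .
  qed
  have "(\<Sum>k<p. poly P (int k) + int k * poly (pderiv P) (int k))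
      = (\<Sum>k<p. \<Sum>i\<le>?D. coeff P i * (int (Suc i) * int k ^ i))"
    unfolding P P' sum.distrib[symmetric] by (simp add: algebra_simps)
  also have "\<dots> = (\<Sum>i\<le>?D. coeff P i * (int (Suc i) * (\<Sum>k<p. int k ^ i)))"
    by (subst sum.swap) (simp add: sum_distrib_left)
  also have "[\<dots> = (\<Sum>i\<le>?D. coeff P i * (if i = ?D then 1 else 0))] (mod int p)"
    by (intro cong_sum cong_scalar_left sum_power_weighted_cong p) simp
  also have "(\<Sum>i\<le>?D. coeff P i * (if i = ?D then 1 else 0)) = coeff P ?D"
    by (simp add: if_distrib[of "(*) _"] cong: if_cong)
  finally show ?thesis .
qed

section \<open>Residues, units and distance in the \<open>p\<close>-adic integers\<close>

lemma padic_residue_mod_self [simp]: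
  "padic_residue (x :: 'p :: prime_card padic_int) n mod int CARD('p) ^ n = padic_residue x n"
  by (rule padic_residue_mod_le) simp

lemma padic_residue_of_int:
  "padic_residue (of_int k :: 'p :: prime_card padic_int) n = k mod int CARD('p) ^ n"
  by (cases k) (simp_all add: padic_residue_of_nat uminus_padic_int.rep_eq mod_minus_eq
      del: of_nat_Suc)

lemma padic_int_exists:
  fixes f :: "nat \<Rightarrow> int"
  assumes "\<And>n. [f (Suc n) = f n] (mod int CARD('p :: prime_card) ^ n)"
  shows "\<exists>z :: 'p padic_int. \<forall>n. padic_residue z n = f n mod int CARD('p) ^ n"
proof -
  let ?g = "\<lambda>n. f n mod int CARD('p) ^ n"
  have "?g n = ?g (Suc n) mod int CARD('p) ^ n" for n
    using assms[of n] by (simp only: mod_pow_Suc cong_def)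
  then have "padic_residue (Abs_padic_int ?g :: 'p padic_int) = ?g"
    by (intro Abs_padic_int_inverse) blast
  then show ?thesis by metis
qed

lemma padic_power_dvd_iff:
  fixes x :: "'p :: prime_card padic_int"
  shows "of_nat CARD('p) ^ k dvd x \<longleftrightarrow> padic_residue x k = 0"
proof
  let ?p = "int CARD('p)"
  have pk: "of_nat CARD('p) ^ k = (of_int (?p ^ k) :: 'p padic_int)" by simp
  {
    assume "of_nat CARD('p) ^ k dvd x"
    then obtain w where "x = of_int (?p ^ k) * w" unfolding pk by (elim dvdE)
    then show "padic_residue x k = 0"
      by (simp add: times_padic_int.rep_eq padic_residue_of_int del: of_int_power)
  }
  assume 0: "padic_residue x k = 0"
  \<comment> \<open>Division by \<open>?p ^ k\<close> costs \<open>k\<close> levels of precision: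
    the quotient modulo \<open>?p ^ n\<close> is read off from the residue at level
    \<open>n + k\<close>.\<close>
  have "\<exists>z :: 'p padic_int. \<forall>n. padic_residue z n = (padic_residue x (n + k) div ?p ^ k) mod ?p ^ n"
  proof (rule padic_int_exists)
    fix n
    have "padic_residue x (n + k) = padic_residue x (Suc n + k) mod (?p ^ k * ?p ^ n)"
      using padic_residue_Suc[of x "n + k"] by (simp add: power_add mult.commute)
    then have "padic_residue x (n + k) div ?p ^ k = padic_residue x (Suc n + k) div ?p ^ k mod ?p ^ n"
      using nontriv[where 'a = 'p] by (simp add: zmod_zmult2_eq)
    then show "[padic_residue x (Suc n + k) div ?p ^ k = padic_residue x (n + k) div ?p ^ k] (mod ?p ^ n)"
      by (simp add: cong_def)
  qed
  then obtain z :: "'p padic_int" where z: "\<And>n. padic_residue z n = (padic_residue x (n + k) div ?p ^ k) mod ?p ^ n" by blast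
  have "x = of_int (?p ^ k) * z"
  proof (rule padic_residue_eqI)
    fix n
    have "?p ^ k dvd padic_residue x (n + k)"
      using padic_residue_mod_le[of k "n + k" x] 0 by (simp add: dvd_eq_mod_eq_0)
    then have "?p ^ k * (padic_residue x (n + k) div ?p ^ k) = padic_residue x (n + k)" by simp
    moreover have "padic_residue (of_int (?p ^ k) * z) n
        = (?p ^ k * (padic_residue x (n + k) div ?p ^ k)) mod ?p ^ n"
      by (simp add: times_padic_int.rep_eq padic_residue_of_int z mod_mult_eq del: of_int_power)
    ultimately show "padic_residue x n = padic_residue (of_int (?p ^ k) * z) n"
      using padic_residue_mod_le[of n "n + k" x] by simp
  qed
  then show "of_nat CARD('p) ^ k dvd x" unfolding pk by simp
qed

lemma padic_power_dvd_diff_iff: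
  fixes x y :: "'p :: prime_card padic_int"
  shows "of_nat CARD('p) ^ k dvd x - y \<longleftrightarrow> padic_residue x k = padic_residue y k"
proof -
  have "padic_residue (x - y) k = 0
      \<longleftrightarrow> padic_residue x k mod int CARD('p) ^ k = padic_residue y k mod int CARD('p) ^ k"
    unfolding minus_padic_int.rep_eq by (metis mod_eq_dvd_iff dvd_eq_mod_eq_0)
  then show ?thesis by (simp add: padic_power_dvd_iff)
qed

text \<open>Inverses modulo each \<open>p ^ n\<close> exist by coprimality; they form a compatible
  sequence because an inverse is unique modulo \<open>p ^ n\<close>.\<close>

lemma padic_unit:
  fixes x :: "'p :: prime_card padic_int"
  assumes "padic_residue x 1 \<noteq> 0"
  obtains y where "x * y = 1"
proof -
  let ?p = "int CARD('p)"
  have cop: "coprime (padic_residue x n) (?p ^ n)" for n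
  proof (cases "n = 0")
    case False
    then have "padic_residue x n mod ?p \<noteq> 0"
      using padic_residue_mod_le[of 1 n x] assms by simp
    then have "\<not> ?p dvd padic_residue x n" by (simp add: dvd_eq_mod_eq_0)
    then have "coprime ?p (padic_residue x n)"
      using prime_card[where 'a = 'p] by (intro prime_imp_coprime) auto
    then show ?thesis by (simp add: coprime_commute)
  qed simp
  then have "\<exists>y. [padic_residue x n * y = 1] (mod ?p ^ n)" for n
    by (intro cong_solve_coprime_int)
  then obtain f where f: "\<And>n. [padic_residue x n * f n = 1] (mod ?p ^ n)" by metis
  have "\<exists>y :: 'p padic_int. \<forall>n. padic_residue y n = f n mod ?p ^ n"
  proof (rule padic_int_exists)
    fix n
    have "[padic_residue x (Suc n) = padic_residue x n] (mod ?p ^ n)"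
      by (simp add: cong_def padic_residue_Suc)
    then have "[padic_residue x n * f (Suc n) = padic_residue x (Suc n) * f (Suc n)] (mod ?p ^ n)"
      using cong_scalar_right cong_sym by blast
    also have "[padic_residue x (Suc n) * f (Suc n) = 1] (mod ?p ^ n)"
      using f[of "Suc n"] by (rule cong_dvd_modulus) simp
    also have "[1 = padic_residue x n * f n] (mod ?p ^ n)"
      using f[of n] by (rule cong_sym)
    finally show "[f (Suc n) = f n] (mod ?p ^ n)"
      using cop[of n] by (simp add: cong_mult_lcancel)
  qed
  then obtain y :: "'p padic_int" where y: "\<And>n. padic_residue y n = f n mod ?p ^ n" by blast
  have "x * y = 1"
    by (rule padic_residue_eqI)
      (use f in \<open>simp add: times_padic_int.rep_eq one_padic_int.rep_eq y mod_mult_right_eq cong_def\<close>)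
  then show ?thesis by (rule that)
qed

lemma dist_padic_int_le:
  fixes x y :: "'p :: prime_card padic_int"
  assumes "padic_residue x k = padic_residue y k"
  shows "dist x y \<le> 1 / real CARD('p) ^ k"
proof (cases "x = y")
  case False
  obtain m where "padic_residue x m \<noteq> padic_residue y m"
    using False padic_residue_eqI by blast
  then have "padic_residue x (Suc m) \<noteq> padic_residue y (Suc m)"
    by (metis padic_residue_Suc)
  then have "padic_residue x (Suc (LEAST n. padic_residue x (Suc n) \<noteq> padic_residue y (Suc n)))
      \<noteq> padic_residue y (Suc (LEAST n. padic_residue x (Suc n) \<noteq> padic_residue y (Suc n)))"
    by (rule LeastI)
  then have "k \<le> (LEAST n. padic_residue x (Suc n) \<noteq> padic_residue y (Suc n))"
    using assms by (metis padic_residue_mod_le not_less_eq_eq)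
  then show ?thesis
    using False nontriv[where 'a = 'p]
    by (auto simp: dist_padic_int_def intro!: divide_left_mono power_increasing)
qed simp

lemma padic_residue_eq_if_dist_less:
  fixes x y :: "'p :: prime_card padic_int"
  assumes "dist x y < 1 / real CARD('p) ^ k"
  shows "padic_residue x k = padic_residue y k"
proof (rule ccontr)
  assume *: "padic_residue x k \<noteq> padic_residue y k"
  then have "padic_residue x (Suc k) \<noteq> padic_residue y (Suc k)"
    by (metis padic_residue_Suc)
  then have "(LEAST n. padic_residue x (Suc n) \<noteq> padic_residue y (Suc n)) \<le> k"
    by (rule Least_le)
  then have "1 / real CARD('p) ^ k \<le> dist x y"
    using * nontriv[where 'a = 'p]
    by (auto simp: dist_padic_int_def intro!: divide_left_mono power_increasing)
  with assms show False by simp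
qed

section \<open>Morita's gamma function modulo powers of \<open>p\<close>\<close>

lemma padic_Gamma_nat_eq:
  "(padic_Gamma_nat N :: 'p :: prime_card padic_int) = of_int ((- 1) ^ N * unit_fact CARD('p) N)"
proof -
  have "{j. 0 < j \<and> j < N \<and> \<not> CARD('p) dvd j} = {j\<in>{..<N}. \<not> CARD('p) dvd j}"
    by (auto intro!: Nat.gr0I)
  then show ?thesis
    by (simp add: padic_Gamma_nat_def unit_fact_def prod_unit_part)
qed

text \<open>The signed values \<open>?h\<close> depend modulo \<open>p ^ n\<close> only on the
  argument modulo \<open>p ^ n\<close>, so the limit \<open>L\<close> can be built level by level,
  and any natural number with the right residue computes it.\<close>

lemma padic_residue_Gamma:
  fixes x :: "'p :: prime_card padic_int"
  assumes odd: "odd CARD('p)" and k: "k \<ge> 1"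
    and N: "int N mod int CARD('p) ^ k = padic_residue x k"
  shows "padic_residue (padic_Gamma x) k = ((- 1) ^ N * unit_fact CARD('p) N) mod int CARD('p) ^ k"
proof -
  let ?p = "CARD('p)"
  let ?h = "\<lambda>N. (- 1) ^ N * unit_fact ?p N"
  let ?F = "inf (filtercomap of_nat (nhds x)) (principal {0<..}) :: nat filter"
  have prime: "prime ?p" by (rule prime_card)
  have p1: "1 < real ?p" using nontriv[where 'a = 'p] by simp
  have nonneg: "padic_residue x n \<ge> 0" for n
    using pos_mod_sign[of "int ?p ^ n" "padic_residue x n"] by simp
  \<comment> \<open>Adding \<open>?p ^ n\<close> keeps the approximation positive even when the
    residue is 0, as the filter in the definition demands.\<close>
  define a where "a n = nat (padic_residue x n) + ?p ^ n" for n
  have a_pos: "a n > 0" for n by (simp add: a_def)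
  have a: "int (a n) mod int ?p ^ n = padic_residue x n" for n
    using nonneg by (simp add: a_def)
  have h_cong: "[?h M = ?h (a n)] (mod int ?p ^ n)"
    if "int M mod int ?p ^ n = padic_residue x n" for M n
  proof (cases "n = 0")
    case False
    have "[int M = int (a n)] (mod int (?p ^ n))"
      using that a[of n] by (simp add: cong_def)
    then have "[M = a n] (mod ?p ^ n)" by (simp only: cong_int_iff)
    then show ?thesis using unit_fact_sign_cong[OF prime odd] False by simp
  qed simp
  have "\<exists>L :: 'p padic_int. \<forall>n. padic_residue L n = ?h (a n) mod int ?p ^ n"
  proof (rule padic_int_exists)
    fix n
    have "int (a (Suc n)) mod int ?p ^ n = padic_residue x n"
      using arg_cong[OF a[of "Suc n"], of "\<lambda>r. r mod int ?p ^ n"]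
      unfolding mod_pow_Suc padic_residue_Suc .
    then show "[?h (a (Suc n)) = ?h (a n)] (mod int ?p ^ n)" by (rule h_cong)
  qed
  then obtain L :: "'p padic_int" where L: "\<And>n. padic_residue L n = ?h (a n) mod int ?p ^ n" by blast
  have arch: "\<exists>n. 1 / real ?p ^ n < e" if "e > 0" for e
    using real_arch_pow_inv[OF that, of "1 / real ?p"] p1 by (simp add: power_one_over)
  have "(padic_Gamma_nat \<longlongrightarrow> L) ?F"
    unfolding tendsto_iff
  proof (intro allI impI)
    fix e :: real assume "e > 0"
    then obtain n where n: "1 / real ?p ^ n < e" using arch by blast
    have "eventually (\<lambda>y. dist y x < 1 / real ?p ^ n) (nhds x)"
      unfolding eventually_nhds_metric using p1 by (intro exI[of _ "1 / real ?p ^ n"]) auto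
    moreover have "dist (padic_Gamma_nat M) L < e" if "dist (of_nat M) x < 1 / real ?p ^ n" for M
    proof -
      have "int M mod int ?p ^ n = padic_residue x n"
        using padic_residue_eq_if_dist_less[OF that] by (simp add: padic_residue_of_nat)
      then have "padic_residue (padic_Gamma_nat M :: 'p padic_int) n = padic_residue L n"
        unfolding padic_Gamma_nat_eq padic_residue_of_int L using h_cong by (simp add: cong_def)
      from dist_padic_int_le[OF this] n show ?thesis by linarith
    qed
    ultimately show "eventually (\<lambda>M. dist (padic_Gamma_nat M) L < e) ?F"
      unfolding eventually_inf_principal eventually_filtercomap by blast
  qed
  \<comment> \<open>Limits are unique only along a proper filter; the points \<open>a n\<close> show
    that positive integers come arbitrarily close to \<open>x\<close>.\<close>
  moreover have "?F \<noteq> bot"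
  proof
    assume "?F = bot"
    then have "eventually (\<lambda>_. False) ?F" by simp
    then obtain Q where Q: "eventually Q (nhds x)" "\<And>M. Q (of_nat M) \<Longrightarrow> \<not> M > 0"
      unfolding eventually_inf_principal eventually_filtercomap by auto
    then obtain e where e: "e > 0" "\<And>y. dist y x < e \<Longrightarrow> Q y"
      unfolding eventually_nhds_metric by blast
    obtain n where "1 / real ?p ^ n < e" using arch e(1) by blast
    moreover have "dist (of_nat (a n)) x \<le> 1 / real ?p ^ n"
      by (rule dist_padic_int_le) (simp add: padic_residue_of_nat a)
    ultimately have "Q (of_nat (a n))" using e(2) by simp
    then show False using Q(2) a_pos by blast
  qed
  ultimately have "padic_Gamma x = L"
    unfolding padic_Gamma_def by (intro tendsto_Lim)
  then show ?thesis using L h_cong[OF N] by (simp add: cong_def)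
qed

section \<open>Calculus of congruences between \<open>p\<close>-adic numbers\<close>

lemma to_fract_of_nat [simp]: "to_fract (of_nat n :: 'a :: idom) = of_nat n"
  by (induction n) simp_all

lemma to_fract_of_int [simp]: "to_fract (of_int n :: 'a :: idom) = of_int n"
  by (cases n) (simp_all del: of_nat_Suc)

text \<open>Restricted to the image of the \<open>p\<close>-adic integers, since
  \<open>padic_cong\<close> includes integrality. Later, \<open>padic_cong k x x\<close> is the way
  to say that \<open>x\<close> is integral.\<close>

lemma padic_cong_refl: "padic_cong k (to_fract u) (to_fract u)"
  unfolding padic_cong_def by (intro exI[of _ u]) simp

lemma padic_cong_left: "padic_cong k x y \<Longrightarrow> padic_cong k x x"
  unfolding padic_cong_def by fastforce

lemma padic_cong_0_right: "padic_cong k x y \<Longrightarrow> padic_cong 0 x 0"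
  unfolding padic_cong_def by (metis power_0 one_dvd to_fract_0)

lemma padic_cong_sym: "padic_cong k x y \<Longrightarrow> padic_cong k y x"
  unfolding padic_cong_def by (metis dvd_minus_iff minus_diff_eq)

lemma padic_cong_trans [trans]: "padic_cong k x y \<Longrightarrow> padic_cong k y z \<Longrightarrow> padic_cong k x z"
proof -
  assume "padic_cong k x y" "padic_cong k y z"
  then obtain u v v' w where "x = to_fract u" "y = to_fract v" "z = to_fract w"
    and "of_nat CARD('a) ^ k dvd u - v" "v' = v" "of_nat CARD('a) ^ k dvd v' - w"
    unfolding padic_cong_def by fastforce
  moreover from this have "of_nat CARD('a) ^ k dvd (u - v) + (v - w)" by (intro dvd_add) auto
  ultimately show ?thesis unfolding padic_cong_def by auto
qed

lemma padic_cong_add: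
  assumes "padic_cong k x y" "padic_cong k x' y'"
  shows "padic_cong k (x + x') (y + y')"
proof -
  obtain u v u' v' where uv: "x = to_fract u" "y = to_fract v" "x' = to_fract u'" "y' = to_fract v'"
    and d: "of_nat CARD('a) ^ k dvd u - v" "of_nat CARD('a) ^ k dvd u' - v'"
    using assms unfolding padic_cong_def by blast
  have "of_nat CARD('a) ^ k dvd (u + u') - (v + v')"
    using dvd_add[OF d] by (simp add: algebra_simps)
  then show ?thesis
    unfolding padic_cong_def uv to_fract_add[symmetric] by blast
qed

lemma padic_cong_mult:
  assumes "padic_cong k x y" "padic_cong k x' y'"
  shows "padic_cong k (x * x') (y * y')"
proof -
  obtain u v u' v' where uv: "x = to_fract u" "y = to_fract v" "x' = to_fract u'" "y' = to_fract v'"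
    and d: "of_nat CARD('a) ^ k dvd u - v" "of_nat CARD('a) ^ k dvd u' - v'"
    using assms unfolding padic_cong_def by blast
  have "u * u' - v * v' = (u - v) * u' + v * (u' - v')" by (simp add: algebra_simps)
  then have "of_nat CARD('a) ^ k dvd u * u' - v * v'" using d by simp
  then show ?thesis
    unfolding padic_cong_def uv to_fract_mult[symmetric] by blast
qed

lemma padic_cong_of_int:
  assumes "[a = b] (mod int CARD('p :: prime_card) ^ k)"
  shows "padic_cong k (of_int a :: 'p padic) (of_int b)"
  unfolding padic_cong_def
  by (rule exI[of _ "of_int a"], rule exI[of _ "of_int b"])
    (use assms in \<open>simp add: padic_power_dvd_diff_iff padic_residue_of_int cong_def\<close>)

lemma padic_cong_of_int_refl: "padic_cong k (of_int a :: 'p :: prime_card padic) (of_int a)"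
  by (rule padic_cong_of_int) simp

lemma padic_cong_sum:
  assumes "\<And>i. i \<in> A \<Longrightarrow> padic_cong k (f i) (g i)"
  shows "padic_cong k (sum f A) (sum g A)"
  using assms
proof (induction A rule: infinite_finite_induct)
  case (insert i A)
  then show ?case by (simp add: padic_cong_add)
qed (use padic_cong_refl[of k 0] in simp_all)

lemma padic_cong_prod:
  assumes "\<And>i. i \<in> A \<Longrightarrow> padic_cong k (f i) (g i)"
  shows "padic_cong k (prod f A) (prod g A)"
  using assms
proof (induction A rule: infinite_finite_induct)
  case (insert i A)
  then show ?case by (simp add: padic_cong_mult)
qed (use padic_cong_refl[of k 1] in simp_all)

lemma padic_cong_mono: "padic_cong k x y \<Longrightarrow> l \<le> k \<Longrightarrow> padic_cong l x y"
  unfolding padic_cong_def using dvd_trans[OF le_imp_power_dvd] by blast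

text \<open>This is why terms carrying a factor \<open>p\<close> need to be known only modulo one
  power less.\<close>

lemma padic_cong_prime_mult:
  assumes "padic_cong k x (y :: 'p :: prime_card padic)"
  shows "padic_cong (Suc k) (of_nat CARD('p) * x) (of_nat CARD('p) * y)"
proof -
  obtain u v where uv: "x = to_fract u" "y = to_fract v" "of_nat CARD('p) ^ k dvd u - v"
    using assms unfolding padic_cong_def by blast
  have "of_nat CARD('p) ^ Suc k dvd of_nat CARD('p) * u - of_nat CARD('p) * v"
    using mult_dvd_mono[OF dvd_refl uv(3), of "of_nat CARD('p)"] by (simp add: right_diff_distrib)
  then show ?thesis
    unfolding padic_cong_def
    by (intro exI[of _ "of_nat CARD('p) * u"] exI[of _ "of_nat CARD('p) * v"]) (simp add: uv)
qed

lemma padic_cong_mult_0: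
  assumes "padic_cong k x (0 :: 'p :: prime_card padic)" "padic_cong l y (0 :: 'p padic)"
  shows "padic_cong (k + l) (x * y) 0"
proof -
  obtain u v where uv: "x = to_fract u" "y = to_fract v"
    "of_nat CARD('p) ^ k dvd u" "of_nat CARD('p) ^ l dvd v"
    using assms unfolding padic_cong_def by fastforce
  then show ?thesis
    unfolding padic_cong_def
    by (intro exI[of _ "u * v"] exI[of _ 0]) (simp add: mult_dvd_mono power_add)
qed

text \<open>With \<open>k \<ge> 1\<close>, \<open>b\<close> has the same nonzero residue modulo
  \<open>p\<close> as \<open>c\<close>, so both are units, and the difference of their inverses is a
  multiple of the difference of \<open>b\<close> and \<open>c\<close>.\<close>

lemma padic_cong_divide:
  fixes x y b :: "'p :: prime_card padic"
  assumes "k \<ge> 1" "padic_cong k x y" "padic_cong k b (of_int c)" "coprime c (int CARD('p))"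
  shows "padic_cong k (x / b) (y / of_int c)"
proof -
  obtain u where u: "b = to_fract u" "of_nat CARD('p) ^ k dvd u - of_int c"
    using assms(3) unfolding padic_cong_def by (metis to_fract_eq_iff to_fract_of_int)
  have c1: "padic_residue (of_int c :: 'p padic_int) 1 \<noteq> 0"
  proof
    assume "padic_residue (of_int c :: 'p padic_int) 1 = 0"
    then have "int CARD('p) dvd c" by (simp add: padic_residue_of_int dvd_eq_mod_eq_0)
    then have "is_unit (int CARD('p))" using assms(4) by (simp add: coprime_absorb_right)
    then show False using nontriv[where 'a = 'p] by simp
  qed
  have "padic_residue u k = padic_residue (of_int c :: 'p padic_int) k"
    using u(2) by (simp add: padic_power_dvd_diff_iff)
  then have "padic_residue u 1 \<noteq> 0"
    using c1 assms(1) padic_residue_mod_le[of 1 k u]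
      padic_residue_mod_le[of 1 k "of_int c :: 'p padic_int"] by simp
  then obtain u' where u': "u * u' = 1" by (rule padic_unit)
  obtain c' :: "'p padic_int" where c': "of_int c * c' = 1" using c1 by (rule padic_unit)
  have b: "inverse b = to_fract u'"
    using arg_cong[OF u', of to_fract] by (intro inverse_unique) (simp add: u(1))
  have c: "inverse (of_int c) = to_fract c'"
    using arg_cong[OF c', of to_fract] by (intro inverse_unique) simp
  have "u' - c' = u' * (of_int c * c') - c' * (u * u')" by (simp add: u' c')
  also have "\<dots> = (u - of_int c) * (- (u' * c'))" by (simp add: algebra_simps)
  finally have "of_nat CARD('p) ^ k dvd u' - c'" using u(2) by simp
  then have "padic_cong k (inverse b) (inverse (of_int c))"
    unfolding padic_cong_def b c by blast
  then show ?thesis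
    unfolding divide_inverse using assms(2) by (intro padic_cong_mult)
qed

lemma padic_cong_divide_int:
  fixes x y :: "'p :: prime_card padic"
  assumes "k \<ge> 1" "padic_cong k x y" "coprime c (int CARD('p))"
  shows "padic_cong k (x / of_int c) (y / of_int c)"
  using assms by (intro padic_cong_divide padic_cong_of_int_refl)

section \<open>Gamma values at fractions with denominator \<open>p - 1\<close>\<close>

text \<open>For odd \<open>p\<close>, Morita's function at \<open>c / (p - 1)\<close> modulo
  \<open>p\<^sup>2\<close>. With \<open>s = p - 1 - c\<close>, the fraction is congruent to
  \<open>1 + s (p + 1)\<close>, which explains the exponent and the sign.\<close>

definition Gamma_residue :: "nat \<Rightarrow> nat \<Rightarrow> int" where
  "Gamma_residue p c = - (fact (p - 1) ^ (p - 1 - c) * shifted_fact p (p - 1 - c))"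

lemma coprime_Gamma_residue: "prime p \<Longrightarrow> coprime (Gamma_residue p c) (int p)"
  unfolding Gamma_residue_def
  by (simp add: coprime_shifted_fact coprime_fact_prime prime_gt_0_nat)

lemma coprime_pred_prime: "coprime (int CARD('p :: prime_card) - 1) (int CARD('p))"
  by (simp add: coprime_diff_one_left)

lemma padic_int_of_rat:
  fixes z :: "'p :: prime_card padic_int"
  assumes "of_rat r = to_fract z"
  shows "padic_int_of_rat r = z"
  unfolding padic_int_of_rat_def by (rule the_equality) (simp_all add: assms)

lemma Gamma_rat_cong:
  assumes odd: "odd CARD('p :: prime_card)" and c: "c \<le> CARD('p) - 1"
  shows "padic_cong 2 (Gamma_rat (of_nat c / of_nat (CARD('p) - 1)) :: 'p padic)
           (of_int (Gamma_residue CARD('p) c))"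
proof -
  let ?p = "CARD('p)"
  have p1: "?p > 1" by (rule nontriv)
  define s where "s = ?p - 1 - c"
  define N where "N = s * ?p + s + 1"
  have "padic_cong 1 (1 / of_int (int ?p - 1) :: 'p padic) (1 / of_int (int ?p - 1))"
    using padic_cong_divide_int[OF _ padic_cong_of_int_refl coprime_pred_prime, of 1 1] by simp
  then obtain y :: "'p padic_int" where y: "1 / of_int (int ?p - 1) = to_fract y"
    unfolding padic_cong_def by blast
  have inv: "of_int (int ?p - 1) * y = 1"
  proof -
    have "of_int (int ?p - 1) \<noteq> (0 :: 'p padic)" using p1 by simp
    then have "to_fract (of_int (int ?p - 1) * y) = to_fract 1"
      by (simp only: to_fract_mult y[symmetric] to_fract_of_int) simp
    then show ?thesis by (simp only: to_fract_eq_iff)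
  qed
  define x :: "'p padic_int" where "x = of_nat c * y"
  have "of_rat (of_nat c / of_nat (?p - 1)) = (of_nat c / of_nat (?p - 1) :: 'p padic)"
    by (simp only: of_rat_divide of_rat_of_nat_eq)
  also have "of_nat (?p - 1) = (of_int (int ?p - 1) :: 'p padic)" using p1 by (simp add: of_nat_diff)
  also have "of_nat c / of_int (int ?p - 1) = to_fract x"
    by (simp add: x_def y[symmetric])
  finally have x: "padic_int_of_rat (of_nat c / of_nat (?p - 1)) = x"
    by (rule padic_int_of_rat)
  \<comment> \<open>Inserting \<open>(p - 1) y = 1\<close> after \<open>N\<close> makes the
    difference a multiple of \<open>y\<close>; the other factor is exactly
    \<open>- p\<^sup>2 s\<close>.\<close>
  have "x - of_int (int N) = of_int (int c) * y - of_int (int N) * (of_int (int ?p - 1) * y)"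
    unfolding inv by (simp add: x_def)
  also have "\<dots> = (of_int (int c) - of_int (int ?p - 1) * of_int (int N)) * y"
    by (simp only: left_diff_distrib right_diff_distrib mult_ac)
  also have "of_int (int c) - of_int (int ?p - 1) * of_int (int N)
      = (of_int (int c - (int ?p - 1) * int N) :: 'p padic_int)" by simp
  also have "int c - (int ?p - 1) * int N = - ((int ?p)\<^sup>2 * int s)"
  proof -
    have "int c = int ?p - 1 - int s" using c p1 by (simp add: s_def of_nat_diff)
    then show ?thesis by (simp add: N_def algebra_simps power2_eq_square)
  qed
  finally have "of_nat ?p ^ 2 dvd x - of_int (int N)" by simp
  then have "int N mod int ?p ^ 2 = padic_residue x 2"
    by (simp only: padic_power_dvd_diff_iff padic_residue_of_int)
  then have "padic_residue (padic_Gamma x) 2 = ((- 1) ^ N * unit_fact ?p N) mod int ?p ^ 2"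
    using odd by (intro padic_residue_Gamma) auto
  \<comment> \<open>\<open>N = s (p + 1) + 1\<close> is odd because \<open>p + 1\<close> is
    even.\<close>
  also have "(- 1) ^ N = (- 1 :: int)" using odd by (simp add: N_def)
  also have "(- 1 * unit_fact ?p N) mod int ?p ^ 2 = Gamma_residue ?p c mod int ?p ^ 2"
    using cong_scalar_left[OF unit_fact_shifted_fact[OF prime_card odd, of s], of "- 1"] p1
    by (simp add: cong_def Gamma_residue_def N_def s_def)
  also have "\<dots> = padic_residue (of_int (Gamma_residue ?p c) :: 'p padic_int) 2"
    by (simp add: padic_residue_of_int)
  finally have "of_nat ?p ^ 2 dvd padic_Gamma x - of_int (Gamma_residue ?p c)"
    by (simp only: padic_power_dvd_diff_iff)
  then show ?thesis
    unfolding padic_cong_def x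
    by (intro exI[of _ "padic_Gamma x"] exI[of _ "of_int (Gamma_residue ?p c)"]) simp
qed

lemma padic_cong_fraction:
  assumes "k \<ge> 1" "[a * d = c * b] (mod int CARD('p :: prime_card) ^ k)"
    and "coprime b (int CARD('p))" "coprime d (int CARD('p))"
  shows "padic_cong k (of_int a / of_int b :: 'p padic) (of_int c / of_int d)"
proof -
  have nz: "b \<noteq> 0" "d \<noteq> 0"
    using assms(3,4) nontriv[where 'a = 'p] by auto
  have "padic_cong k (of_int (a * d) / of_int (b * d) :: 'p padic) (of_int (c * b) / of_int (b * d))"
    using assms by (intro padic_cong_divide_int padic_cong_of_int) auto
  then show ?thesis using nz by (simp add: mult.commute)
qed

lemma padic_cong_add_prime_square:
  assumes "padic_cong 2 x (y :: 'p :: prime_card padic)" "padic_cong 2 w w'"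
  shows "padic_cong 2 (x + of_nat CARD('p) * (of_nat CARD('p) * w)) y"
proof -
  have "padic_cong 0 w 0" using assms(2) by (rule padic_cong_0_right)
  then have "padic_cong (Suc (Suc 0)) (of_nat CARD('p) * (of_nat CARD('p) * w))
      (of_nat CARD('p) * (of_nat CARD('p) * 0))"
    by (intro padic_cong_prime_mult)
  then show ?thesis
    using padic_cong_add[OF assms(1)] by (fastforce simp: numeral_2_eq_2)
qed

text \<open>The powers of \<open>(p - 1)!\<close> combine to exponent \<open>p - 1\<close>, the
  reflected shifted factorials supply one more, and \<open>(p - 1)! ^ p\<close> is -1 modulo
  \<open>p\<^sup>2\<close> by Wilson's theorem and lifting.\<close>

lemma Gamma_residue_reflect:
  assumes p: "prime p" "odd p" and k: "k \<le> p - 1"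
  shows "[(- 1) ^ k * Gamma_residue p k * shifted_fact p k * fact (p - 1) ^ k = 1] (mod (int p)\<^sup>2)"
proof -
  let ?W = "fact (p - 1) :: int"
  have p0: "p > 0" using p(1) by (simp add: prime_gt_0_nat)
  have "p - 1 - k + k = p - 1" using k by simp
  then have "?W ^ (p - 1 - k) * ?W ^ k = ?W ^ (p - 1)" unfolding power_add[symmetric] by (simp only:)
  then have "(- 1) ^ k * Gamma_residue p k * shifted_fact p k * ?W ^ k
      = - (?W ^ (p - 1) * ((- 1) ^ k * shifted_fact p (p - 1 - k) * shifted_fact p k))"
    by (simp add: Gamma_residue_def mult_ac)
  also have "[\<dots> = - (?W ^ (p - 1) * ?W)] (mod (int p)\<^sup>2)"
    using shifted_fact_reflect[OF assms] by (intro cong_uminus cong_scalar_left)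
  also have "?W ^ (p - 1) * ?W = ?W ^ p" using p0 by (simp add: power_eq_if mult.commute)
  also have "[- (?W ^ p) = - ((- 1) ^ p)] (mod (int p)\<^sup>2)"
    using cong_pow_prime_lift[of ?W "- 1" p 1] wilson_theorem[OF p(1)]
    by (intro cong_uminus) (simp add: numeral_2_eq_2)
  finally show ?thesis using p(2) by simp
qed

text \<open>Modulo \<open>p\<close> the shifted factorial becomes \<open>k!\<close>, and
  \<open>(p - 1)! ^ k\<close> becomes \<open>(- 1) ^ k\<close>, cancelling the sign. This evaluates
  the gamma product in \<open>\<delta>\<close>.\<close>

lemma Gamma_residue_cong_inverse_fact:
  assumes p: "prime p" "odd p" and k: "k \<le> p - 1"
  shows "[Gamma_residue p k * fact k = 1] (mod int p)"
proof -
  have "[(- 1) ^ k * Gamma_residue p k * shifted_fact p k * fact (p - 1) ^ k = 1] (mod int p)"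
    using Gamma_residue_reflect[OF assms] by (rule cong_dvd_modulus) simp
  moreover have "[(- 1) ^ k * Gamma_residue p k * shifted_fact p k * fact (p - 1) ^ k
      = (- 1) ^ k * Gamma_residue p k * fact k * (- 1) ^ k] (mod int p)"
    by (intro cong_mult cong_refl cong_pow shifted_fact_cong_fact wilson_theorem p(1))
  moreover have "(- 1) ^ k * Gamma_residue p k * fact k * (- 1) ^ k = Gamma_residue p k * fact k"
    by (simp add: mult_ac power_mult_distrib[symmetric])
  ultimately show ?thesis using cong_sym cong_trans by metis
qed

section \<open>Factors of \<open>G\<close> and of the hypergeometric series modulo
  \<open>p\<^sup>2\<close>\<close>

text \<open>\<open>X\<close> stands for the gamma value at the fractional part together with its
  power of \<open>-p\<close>; it has the same form for both values of the floor. By the reflection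
  formula all powers of \<open>(p - 1)!\<close> cancel.\<close>

lemma Gamma_quotient_cong:
  assumes odd: "odd CARD('p :: prime_card)" and s: "s < CARD('p)" and k: "k < CARD('p)"
    and X: "[X = - (fact (CARD('p) - 1) ^ (s + k) * shifted_fact CARD('p) (s + k))] (mod (int CARD('p))\<^sup>2)"
  shows "padic_cong 2
    (of_int ((- 1) ^ k * Gamma_residue CARD('p) k * X)
       / of_int (Gamma_residue CARD('p) (CARD('p) - 1 - s)) :: 'p padic)
    (of_int (shifted_fact CARD('p) (s + k))
       / of_int (shifted_fact CARD('p) s * shifted_fact CARD('p) k))"
proof (rule padic_cong_fraction)
  let ?p = "CARD('p)"
  let ?V = "shifted_fact ?p" and ?W = "fact (?p - 1) :: int" and ?g = "Gamma_residue ?p"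
  have prime: "prime ?p" by (rule prime_card)
  show "coprime (?g (?p - 1 - s)) (int ?p)" by (rule coprime_Gamma_residue[OF prime])
  show "coprime (?V s * ?V k) (int ?p)"
    using s k by (simp add: coprime_shifted_fact[OF prime])
  have gr: "?g (?p - 1 - s) = - (?W ^ s * ?V s)"
    using s by (simp add: Gamma_residue_def)
  have "[(- 1) ^ k * ?g k * X * (?V s * ?V k)
      = (- 1) ^ k * ?g k * (- (?W ^ (s + k) * ?V (s + k))) * (?V s * ?V k)] (mod (int ?p)\<^sup>2)"
    by (intro cong_mult cong_refl X)
  also have "(- 1) ^ k * ?g k * (- (?W ^ (s + k) * ?V (s + k))) * (?V s * ?V k)
      = (- 1) ^ k * ?g k * ?V k * ?W ^ k * (?V (s + k) * ?g (?p - 1 - s))"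
    unfolding gr by (simp add: power_add mult_ac)
  also have "[\<dots> = 1 * (?V (s + k) * ?g (?p - 1 - s))] (mod (int ?p)\<^sup>2)"
    by (rule cong_scalar_right[OF Gamma_residue_reflect[OF prime odd]]) (use k in simp)
  finally show "[(- 1) ^ k * ?g k * X * (?V s * ?V k) = ?V (s + k) * ?g (?p - 1 - s)] (mod int ?p ^ 2)"
    by simp
qed simp

text \<open>With \<open>r = p - 1 - s\<close>, the floor of \<open>a - t\<close> is 0 if
  \<open>k \<le> r\<close> and -1 otherwise. In the second case \<open>s + k \<ge> p\<close>, and
  the \<open>p\<close> inside \<open>shifted_fact p (s + k)\<close> matches the factor
  \<open>-p\<close>.\<close>

lemma padic_G_factor_cong:
  assumes odd: "odd CARD('p :: prime_card)" and s: "0 < s" "s < CARD('p)" and k: "k < CARD('p) - 1"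
    and a: "a = of_nat (CARD('p) - 1 - s) / of_nat (CARD('p) - 1)"
    and t: "t = of_nat k / of_nat (CARD('p) - 1)"
  shows "padic_cong 2
    ((- 1) ^ k * Gamma_rat t
      * (Gamma_rat (frac (a - t)) / Gamma_rat a * (- of_nat CARD('p)) powi (- \<lfloor>a - t\<rfloor>)) :: 'p padic)
    (of_int (shifted_fact CARD('p) (s + k))
       / of_int (shifted_fact CARD('p) s * shifted_fact CARD('p) k))"
proof -
  let ?p = "CARD('p)"
  let ?V = "shifted_fact ?p" and ?W = "fact (?p - 1) :: int" and ?g = "Gamma_residue ?p"
  define r where "r = ?p - 1 - s"
  have prime: "prime ?p" by (rule prime_card)
  have p1: "?p > 1" by (rule nontriv)
  have p1': "(of_nat (?p - 1) :: rat) > 0" using p1 by simp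
  have a': "a = of_nat r / of_nat (?p - 1)" unfolding a r_def ..
  have rs: "r + s = ?p - 1" using s by (simp add: r_def)
  have Gt: "padic_cong 2 ((- 1) ^ k * Gamma_rat t :: 'p padic) (of_int ((- 1) ^ k * ?g k))"
    using padic_cong_mult[OF padic_cong_of_int_refl[of 2 "(- 1) ^ k"] Gamma_rat_cong[OF odd, of k]] k
    by (simp add: t)
  have Ga: "padic_cong 2 (Gamma_rat a :: 'p padic) (of_int (?g r))"
    unfolding a r_def by (rule Gamma_rat_cong[OF odd]) simp
  \<comment> \<open>Only the value at the fractional part depends on the floor; everything else is
    settled here for both cases.\<close>
  have main: ?thesis
    if Y: "padic_cong 2 (Gamma_rat (frac (a - t)) * (- of_nat ?p) powi (- \<lfloor>a - t\<rfloor>) :: 'p padic) (of_int X)"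
      and X: "[X = - (?W ^ (s + k) * ?V (s + k))] (mod (int ?p)\<^sup>2)" for X
  proof -
    have "padic_cong 2
      (((- 1) ^ k * Gamma_rat t) * (Gamma_rat (frac (a - t)) * (- of_nat ?p) powi (- \<lfloor>a - t\<rfloor>))
        / Gamma_rat a :: 'p padic)
      (of_int ((- 1) ^ k * ?g k) * of_int X / of_int (?g r))"
      by (intro padic_cong_divide padic_cong_mult Gt Y Ga coprime_Gamma_residue prime) simp
    also have "of_int ((- 1) ^ k * ?g k) * of_int X / of_int (?g r)
        = (of_int ((- 1) ^ k * ?g k * X) / of_int (?g (?p - 1 - s)) :: 'p padic)"
      by (simp add: r_def)
    also have "padic_cong 2 \<dots> (of_int (?V (s + k)) / of_int (?V s * ?V k))"
      by (rule Gamma_quotient_cong[OF odd s(2) _ X]) (use k in simp)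
    finally show ?thesis by (simp add: mult_ac)
  qed
  show ?thesis
  proof (cases "k \<le> r")
    case True
    have at: "a - t = of_nat (r - k) / of_nat (?p - 1)"
      using True by (simp add: a' t of_nat_diff diff_divide_distrib)
    have lt: "r - k < ?p - 1" using rs s True by linarith
    then have fl: "\<lfloor>a - t\<rfloor> = 0"
      unfolding at floor_eq_iff using p1' by (simp add: field_simps del: of_nat_diff)
    show ?thesis
    proof (rule main)
      show "padic_cong 2 (Gamma_rat (frac (a - t)) * (- of_nat ?p) powi (- \<lfloor>a - t\<rfloor>) :: 'p padic)
          (of_int (?g (r - k)))"
        using Gamma_rat_cong[OF odd, of "r - k"] lt unfolding frac_def fl by (simp add: at)
      have "?p - 1 - (r - k) = s + k" using rs True by simp
      then show "[?g (r - k) = - (?W ^ (s + k) * ?V (s + k))] (mod (int ?p)\<^sup>2)"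
        by (simp add: Gamma_residue_def)
    qed
  next
    case False
    \<comment> \<open>Numerator of the fractional part: 1 is added to the negative number
      \<open>a - t\<close>.\<close>
    define c where "c = r + (?p - 1) - k"
    have c: "c < ?p - 1" "r + (?p - 1) = c + k" using False k by (auto simp: c_def)
    have "of_nat r + of_nat (?p - 1) = (of_nat c + of_nat k :: rat)"
      using c(2) by (simp only: of_nat_add[symmetric])
    then have "of_nat r - of_nat k = (of_nat c - of_nat (?p - 1) :: rat)"
      by linarith
    then have at: "a - t = of_nat c / of_nat (?p - 1) - 1"
      using p1' by (simp only: a' t diff_divide_distrib[symmetric]) (simp add: field_simps)
    have fl: "\<lfloor>a - t\<rfloor> = - 1"
      unfolding at floor_eq_iff using p1' c(1) by (simp add: field_simps del: of_nat_diff)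
    have sk: "?p \<le> s + k" "s + k < 2 * ?p" using rs False s k by auto
    define m where "m = s + k - (?p - 1)"
    have m: "?p - 1 - c = m" "s + k = m + (?p - 1)" using c rs sk by (auto simp: m_def)
    obtain z where z: "?V (s + k) = int ?p * z" "[z = - ?V m] (mod int ?p)"
      using shifted_fact_ge[OF prime sk(1)] sk(2) unfolding m_def by blast
    show ?thesis
    proof (rule main)
      have "padic_cong 2 (Gamma_rat (of_nat c / of_nat (?p - 1)) * of_int (- int ?p) :: 'p padic)
          (of_int (?g c) * of_int (- int ?p))"
        using c(1) by (intro padic_cong_mult Gamma_rat_cong[OF odd] padic_cong_of_int_refl) simp
      then show "padic_cong 2 (Gamma_rat (frac (a - t)) * (- of_nat ?p) powi (- \<lfloor>a - t\<rfloor>) :: 'p padic)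
          (of_int (?g c * - int ?p))"
        unfolding frac_def fl by (simp add: at)
      have "even (?p - 1)" using odd p1 by simp
      have "[?W ^ (s + k) * z = ?W ^ m * (- 1) ^ (?p - 1) * - ?V m] (mod int ?p)"
        unfolding m(2) power_add
        by (intro cong_mult cong_refl cong_pow wilson_theorem prime z(2))
      also have "?W ^ m * (- 1) ^ (?p - 1) * - ?V m = ?g c"
        unfolding Gamma_residue_def m(1) using \<open>even (?p - 1)\<close> by simp
      finally have "[?g c = ?W ^ (s + k) * z] (mod int ?p)" by (rule cong_sym)
      \<comment> \<open>The prefactor \<open>p\<close> upgrades a congruence modulo \<open>p\<close>
        to one modulo \<open>p\<^sup>2\<close>.\<close>
      then have "[int ?p * ?g c = int ?p * (?W ^ (s + k) * z)] (mod int ?p * int ?p)"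
        by (rule cong_cmult_leftI)
      from cong_uminus[OF this] show "[?g c * - int ?p = - (?W ^ (s + k) * ?V (s + k))] (mod (int ?p)\<^sup>2)"
        unfolding z(1) by (simp add: power2_eq_square mult_ac)
    qed
  qed
qed

text \<open>\<open>pochhammer\<close> starts at its argument, \<open>rising_poly\<close> one above
  it, hence \<open>b + 1\<close> against \<open>b\<close>.\<close>

lemma pochhammer_cong:
  fixes x :: "'p :: prime_card padic"
  assumes "padic_cong l x (of_int (b + 1))"
  shows "padic_cong l (pochhammer x k) (of_int (poly (rising_poly k) b))"
proof (induction k)
  case 0
  then show ?case using padic_cong_of_int_refl[of l 1] by (simp add: rising_poly_def)
next
  case (Suc k)
  have "padic_cong l (x + of_int (int k)) (of_int (b + 1) + of_int (int k))"
    by (intro padic_cong_add assms padic_cong_of_int_refl)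
  from padic_cong_mult[OF Suc this] show ?case
    by (simp add: pochhammer_Suc poly_rising_poly add_ac)
qed

text \<open>Since \<open>x\<close> is \<open>1 + s + p s\<close> modulo \<open>p\<^sup>2\<close>,
  the Pochhammer symbol is \<open>rising_poly k\<close> at \<open>?b\<close>, and
  \<open>shifted_fact_add\<close> gives the first claim. In the second, both quotients are the
  binomial coefficient of \<open>s + k\<close> over \<open>s\<close> modulo \<open>p\<close>; the
  exchange makes the factor polynomial in \<open>k\<close>.\<close>

lemma hypergeom_factor_cong:
  fixes x :: "'p :: prime_card padic"
  assumes s: "s < CARD('p)" and k: "k < CARD('p)"
    and x: "x = of_nat (CARD('p) - 1 - s) / of_nat (CARD('p) - 1)"
  shows "padic_cong 2
      (of_int (shifted_fact CARD('p) (s + k))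
        / of_int (shifted_fact CARD('p) s * shifted_fact CARD('p) k))
      (pochhammer x k / of_int (fact k)
        + of_nat CARD('p) * (of_nat k * (of_int (poly (pderiv (rising_poly s)) (int k)) / of_int (fact s))))"
    (is ?th1)
    and "padic_cong 1 (pochhammer x k / of_int (fact k))
      (of_int (poly (rising_poly s) (int k)) / of_int (fact s))"
    (is ?th2)
proof -
  let ?p = "CARD('p)"
  have prime: "prime ?p" by (rule prime_card)
  have p1: "?p > 1" by (rule nontriv)
  have cop: "coprime (fact m :: int) (int ?p)" if "m < ?p" for m
    using prime that by (rule coprime_fact_prime)
  let ?b = "int s + int ?p * int s"
  have pm: "int (?p - 1) = int ?p - 1" using p1 by (simp add: of_nat_diff)
  have "padic_cong 2 (of_int (int (?p - 1 - s)) / of_int (int ?p - 1) :: 'p padic)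
      (of_int (?b + 1) / of_int 1)"
  proof (rule padic_cong_fraction)
    have "int (?p - 1 - s) - (?b + 1) * (int ?p - 1) = int ?p ^ 2 * - int s"
      using s by (simp add: of_nat_diff algebra_simps power2_eq_square)
    then show "[int (?p - 1 - s) * 1 = (?b + 1) * (int ?p - 1)] (mod int ?p ^ 2)"
      by (simp add: cong_iff_dvd_diff)
  qed (simp_all add: coprime_pred_prime)
  then have "padic_cong 2 x (of_int (?b + 1))"
    unfolding x pm[symmetric] by (simp only: of_int_of_nat_eq of_int_1 div_by_1)
  then have poch: "padic_cong 2 (pochhammer x k) (of_int (poly (rising_poly k) ?b))"
    by (rule pochhammer_cong)
  have F: "padic_cong 2 (pochhammer x k / of_int (fact k))
      (of_int (poly (rising_poly k) ?b) / of_int (fact k))"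
    using poch cop[OF k] by (intro padic_cong_divide_int) auto
  let ?u = "poly (pderiv (rising_poly s)) (int k)"
  have "padic_cong 2
      (of_int (shifted_fact ?p (s + k)) / of_int (shifted_fact ?p s * shifted_fact ?p k) :: 'p padic)
      (of_int (fact s * poly (rising_poly k) ?b + int ?p * (int k * fact k * ?u))
        / of_int (fact k * fact s))"
  proof (rule padic_cong_fraction)
    show "[shifted_fact ?p (s + k) * (fact k * fact s)
        = (fact s * poly (rising_poly k) ?b + int ?p * (int k * fact k * ?u))
          * (shifted_fact ?p s * shifted_fact ?p k)] (mod int ?p ^ 2)"
      using shifted_fact_add[of k s ?p] by (simp only: mult_ac)
  qed (use s k cop coprime_shifted_fact[OF prime] in auto)
  also have "of_int (fact s * poly (rising_poly k) ?b + int ?p * (int k * fact k * ?u))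
        / of_int (fact k * fact s)
      = (of_int (poly (rising_poly k) ?b) / of_int (fact k)
        + of_nat ?p * (of_nat k * (of_int ?u / of_int (fact s))) :: 'p padic)"
    by (simp add: field_simps)
  also have "padic_cong 2 \<dots> (pochhammer x k / of_int (fact k)
        + of_nat ?p * (of_nat k * (of_int ?u / of_int (fact s))))"
  proof (intro padic_cong_add padic_cong_sym[OF F])
    have "padic_cong 2 (of_int (int ?p * (int k * ?u)) / of_int (fact s) :: 'p padic)
        (of_int (int ?p * (int k * ?u)) / of_int (fact s))"
      using cop[OF s] by (intro padic_cong_divide_int padic_cong_of_int_refl) auto
    then show "padic_cong 2 (of_nat ?p * (of_nat k * (of_int ?u / of_int (fact s))) :: 'p padic)
        (of_nat ?p * (of_nat k * (of_int ?u / of_int (fact s))))"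
      by simp
  qed
  finally show ?th1 .
  have "padic_cong 1 (pochhammer x k / of_int (fact k))
      (of_int (poly (rising_poly k) ?b) / of_int (fact k))"
    using F by (rule padic_cong_mono) simp
  also have "padic_cong 1 (of_int (poly (rising_poly k) ?b) / of_int (fact k) :: 'p padic)
      (of_int (poly (rising_poly s) (int k)) / of_int (fact s))"
  proof (rule padic_cong_fraction)
    have "[poly (rising_poly k) ?b = poly (rising_poly k) (int s)] (mod int ?p)"
      unfolding poly_rising_poly by (intro cong_prod) (simp add: cong_iff_dvd_diff)
    from cong_scalar_left[OF this, of "fact s"]
    have "[fact s * poly (rising_poly k) ?b = fact (s + k)] (mod int ?p)"
      by (simp only: fact_mult_poly_rising_poly)
    also have "fact (s + k) = fact k * poly (rising_poly s) (int k)"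
      by (simp add: fact_mult_poly_rising_poly add.commute)
    finally show "[poly (rising_poly k) ?b * fact s
        = poly (rising_poly s) (int k) * fact k] (mod int ?p ^ 1)"
      by (simp only: mult.commute power_one_right)
  qed (use s k cop in auto)
  finally show ?th2 .
qed

text \<open>Product rule, one index at a time: terms with \<open>p\<^sup>2\<close> drop out, and
  inside the coefficient of \<open>p\<close> each \<open>f i\<close> may be replaced by the value of
  \<open>Q i\<close> over \<open>e i\<close>, known only modulo \<open>p\<close>.\<close>

lemma padic_cong_prod_pderiv:
  fixes g f :: "'i \<Rightarrow> 'p :: prime_card padic" and Q :: "'i \<Rightarrow> int poly" and e :: "'i \<Rightarrow> int"
  assumes "finite I"
    and g: "\<And>i. i \<in> I \<Longrightarrow> padic_cong 2 (g i)
      (f i + of_nat CARD('p) * (of_nat k * (of_int (poly (pderiv (Q i)) x) / of_int (e i))))"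
    and f: "\<And>i. i \<in> I \<Longrightarrow> padic_cong 2 (f i) (f i)"
    and q: "\<And>i. i \<in> I \<Longrightarrow> padic_cong 1 (f i) (of_int (poly (Q i) x) / of_int (e i))"
    and e: "\<And>i. i \<in> I \<Longrightarrow> coprime (e i) (int CARD('p))"
  shows "padic_cong 2 (\<Prod>i\<in>I. g i) ((\<Prod>i\<in>I. f i)
    + of_nat CARD('p) * (of_nat k * (of_int (poly (pderiv (\<Prod>i\<in>I. Q i)) x) / of_int (\<Prod>i\<in>I. e i))))"
  using assms
proof (induction I rule: finite_induct)
  case empty
  then show ?case using padic_cong_of_int_refl[of 2 1] by simp
next
  case (insert i I)
  let ?p = "of_nat CARD('p) :: 'p padic"
  define F where "F = (\<Prod>i\<in>I. f i)"
  define P where "P = (\<Prod>i\<in>I. Q i)"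
  define E where "E = (\<Prod>i\<in>I. e i)"
  define q where "q = (of_int (poly (Q i) x) / of_int (e i) :: 'p padic)"
  define q' where "q' = (of_int (poly (pderiv (Q i)) x) / of_int (e i) :: 'p padic)"
  define R where "R = (of_int (poly P x) / of_int E :: 'p padic)"
  define R' where "R' = (of_int (poly (pderiv P) x) / of_int E :: 'p padic)"
  have cE: "coprime (e i) (int CARD('p))" "coprime E (int CARD('p))"
    unfolding E_def using insert.prems(4) by (auto intro: prod_coprime_left)
  have nz: "e i \<noteq> 0" "E \<noteq> 0" using cE nontriv[where 'a = 'p] by auto
  have kk: "padic_cong l (of_nat k) (of_nat k :: 'p padic)" for l
    using padic_cong_of_int_refl[of l "int k"] by simp
  have int: "padic_cong l q' q'" "padic_cong l R' R'" if "l \<ge> 1" for l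
    unfolding q'_def R'_def using that cE
    by (auto intro!: padic_cong_divide_int padic_cong_of_int_refl)
  have fF: "padic_cong 2 (f i) (f i)" "padic_cong 2 F F"
    unfolding F_def by (intro padic_cong_prod insert.prems; simp)+
  have fq: "padic_cong 1 (f i) q" unfolding q_def by (intro insert.prems) simp
  have "padic_cong 1 F (\<Prod>i\<in>I. of_int (poly (Q i) x) / of_int (e i))"
    unfolding F_def by (intro padic_cong_prod insert.prems) simp
  then have FR: "padic_cong 1 F R"
    by (simp add: R_def P_def E_def poly_prod prod_dividef)
  have "padic_cong 2 (g i * (\<Prod>i\<in>I. g i))
      ((f i + ?p * (of_nat k * q')) * (F + ?p * (of_nat k * R')))"
    using insert.prems unfolding q'_def R'_def F_def P_def E_def
    by (intro padic_cong_mult insert.IH) auto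
  also have "(f i + ?p * (of_nat k * q')) * (F + ?p * (of_nat k * R'))
      = f i * F + ?p * (of_nat k * (q' * F + f i * R')) + ?p * (?p * (of_nat k * q' * (of_nat k * R')))"
    by (simp add: algebra_simps)
  also have "padic_cong 2 \<dots> (f i * F + ?p * (of_nat k * (q' * R + q * R')))"
  proof (rule padic_cong_add_prime_square)
    have "padic_cong 1 (of_nat k * (q' * F + f i * R')) (of_nat k * (q' * R + q * R'))"
      by (intro padic_cong_mult padic_cong_add int kk fq FR) simp_all
    from padic_cong_prime_mult[OF this]
    have "padic_cong 2 (?p * (of_nat k * (q' * F + f i * R'))) (?p * (of_nat k * (q' * R + q * R')))"
      by (simp add: numeral_2_eq_2)
    then show "padic_cong 2 (f i * F + ?p * (of_nat k * (q' * F + f i * R')))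
        (f i * F + ?p * (of_nat k * (q' * R + q * R')))"
      by (rule padic_cong_add[OF padic_cong_mult[OF fF]])
    show "padic_cong 2 (of_nat k * q' * (of_nat k * R')) (of_nat k * q' * (of_nat k * R'))"
      by (intro padic_cong_mult int kk) auto
  qed
  also have "q' * R + q * R' = of_int (poly (pderiv (Q i * P)) x) / of_int (e i * E)"
    using nz by (simp add: q_def q'_def R_def R'_def pderiv_mult field_simps)
  finally show ?case using insert.hyps by (simp add: F_def P_def E_def)
qed

section \<open>The rational series and the product polynomial\<close>

lemma of_rat_prod: "of_rat (prod f A) = (\<Prod>x\<in>A. of_rat (f x))"
  by (induction A rule: infinite_finite_induct) (auto simp: of_rat_mult)

lemma of_rat_pochhammer: "of_rat (pochhammer a k) = pochhammer (of_rat a) k"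
  by (simp add: pochhammer_prod of_rat_prod of_rat_add)

lemma of_rat_fact: "of_rat (fact k) = of_int (fact k)"
  by (metis of_int_fact of_rat_of_int_eq)

text \<open>The \<open>n\<close> lower parameters 1 and the \<open>k!\<close> of the series give
  \<open>n + 1\<close> factorials, one for each upper parameter.\<close>

lemma trunc_hypergeom_at_1:
  "of_rat (trunc_hypergeom (map a [1..<n + 2]) (replicate n 1) 1 m)
     = (\<Sum>k\<le>m. \<Prod>i = 1..n + 1. pochhammer (of_rat (a i)) k / of_int (fact k))"
proof -
  have "(\<Prod>x\<leftarrow>map a [1..<n + 2]. pochhammer x k) = (\<Prod>i = 1..n + 1. pochhammer (a i) k)" for k
  proof -
    have "{1..n + 1} = set [1..<n + 2]" by auto
    then show ?thesis by (simp only: prod.distinct_set_conv_list[OF distinct_upt] map_map comp_def)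
  qed
  then have "(\<Prod>x\<leftarrow>map a [1..<n + 2]. pochhammer x k) / (\<Prod>b\<leftarrow>replicate n 1. pochhammer b k) * 1 ^ k / fact k
      = (\<Prod>i = 1..n + 1. pochhammer (a i) k / fact k)" for k
    unfolding prod_dividef
    by (simp only:) (simp add: pochhammer_fact[symmetric] mult.commute)
  then have "trunc_hypergeom (map a [1..<n + 2]) (replicate n 1) 1 m
      = (\<Sum>k\<le>m. \<Prod>i = 1..n + 1. pochhammer (a i) k / fact k)"
    unfolding trunc_hypergeom_def by (simp only: atMost_atLeast0)
  then show ?thesis
    by (simp only: of_rat_sum of_rat_prod of_rat_divide of_rat_pochhammer of_rat_fact)
qed

lemma coeff_prod_rising_poly:
  assumes "finite I"
  shows "degree (\<Prod>i\<in>I. rising_poly (s i)) = (\<Sum>i\<in>I. s i)"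
    and "coeff (\<Prod>i\<in>I. rising_poly (s i)) (\<Sum>i\<in>I. s i) = 1"
proof -
  have nz: "rising_poly (s i) \<noteq> 0" for i using lead_coeff_rising_poly[of "s i"] by auto
  show deg: "degree (\<Prod>i\<in>I. rising_poly (s i)) = (\<Sum>i\<in>I. s i)"
    using nz by (simp add: degree_prod_eq_sum_degree degree_rising_poly)
  have "lead_coeff (\<Prod>i\<in>I. rising_poly (s i)) = 1"
    by (simp add: lead_coeff_prod lead_coeff_rising_poly)
  then show "coeff (\<Prod>i\<in>I. rising_poly (s i)) (\<Sum>i\<in>I. s i) = 1" by (simp only: deg)
qed

section \<open>Comparison of \<open>G\<close> with the truncated series modulo
  \<open>p\<^sup>2\<close>\<close>

theorem theorem2p3:
  fixes n :: nat and m d :: "nat \<Rightarrow> nat" and a :: "nat \<Rightarrow> rat" and S :: rat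
    and \<rho> :: "nat \<Rightarrow> 'p :: prime_card mod_ring \<Rightarrow> 'p padic" and \<delta> :: "'p padic"
  assumes n: "n > 0"
    and m_pos: "\<forall>i\<in>{1..n + 1}. m i > 0"
    and d_pos: "\<forall>i\<in>{1..n + 1}. d i > 0"
    and a_def: "\<forall>i\<in>{1..n + 1}. a i = of_nat (m i) / of_nat (d i)"
    and a_range: "\<forall>i\<in>{1..n + 1}. 0 < a i \<and> a i < 1"
    and p_cong: "\<forall>i\<in>{1..n + 1}. [CARD('p) = 1] (mod d i)"
    and \<rho>_def: "\<forall>i\<in>{1..n + 1}. \<forall>x.
          \<rho> i x = inverse (to_fract (teichmuller x)) ^ ((CARD('p) - 1) div d i)"
    and S_def: "S = (\<Sum>i = 1..n + 1. a i)"
    and S_ge: "S \<ge> of_nat n - 1"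
    and \<delta>_def: "\<delta> = (if S = of_nat n - 1 then \<Prod>i = 1..n + 1. Gamma_rat (1 - a i) else 0)"
  shows "padic_cong 2 (padic_G n a)
           (of_rat (trunc_hypergeom (map a [1..<n + 2]) (replicate n 1) 1 (CARD('p) - 1))
            + \<delta> * of_nat CARD('p))"
proof -
  let ?p = "CARD('p)"
  let ?q = "of_nat ?p :: 'p padic"
  let ?I = "{1..n + 1}"
  let ?V = "shifted_fact ?p"
  have prime: "prime ?p" by (rule prime_card)
  have p1: "?p > 1" by (rule nontriv)
  have p1': "(of_nat (?p - 1) :: rat) > 0" using p1 by simp
  \<comment> \<open>Writing \<open>p - 1 = d i * e\<close> brings \<open>a i\<close> to denominator
    \<open>p - 1\<close> with numerator \<open>m i * e\<close>; \<open>s\<close> is the complement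
    of that numerator in \<open>p - 1\<close>.\<close>
  have "\<exists>s. 0 < s \<and> s < ?p - 1 \<and> a i = of_nat (?p - 1 - s) / of_nat (?p - 1)" if i: "i \<in> ?I" for i
  proof -
    have "d i dvd ?p - 1" using p_cong i p1 by (auto simp: cong_altdef_nat)
    then obtain e where e: "?p - 1 = d i * e" by (elim dvdE)
    then have e0: "e > 0" using p1 by (cases e) auto
    have a: "a i = of_nat (m i * e) / of_nat (?p - 1)"
      using a_def i e0 unfolding e by simp
    have pos: "0 < m i * e" using m_pos i e0 by simp
    have "a i < 1" using a_range i by blast
    then have less: "m i * e < ?p - 1"
      unfolding a by (simp only: divide_less_eq_1_pos[OF p1'] of_nat_less_iff)
    have "?p - 1 - (?p - 1 - m i * e) = m i * e" using less by linarith
    moreover have "0 < ?p - 1 - m i * e" "?p - 1 - m i * e < ?p - 1" using pos less by linarith+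
    ultimately show ?thesis
      unfolding a by (intro exI[of _ "?p - 1 - m i * e"]) (simp only: simp_thms)
  qed
  then obtain s where s: "\<And>i. i \<in> ?I \<Longrightarrow> 0 < s i \<and> s i < ?p - 1 \<and> a i = of_nat (?p - 1 - s i) / of_nat (?p - 1)"
    by metis
  \<comment> \<open>An integer strictly between 0 and \<open>p - 1\<close> excludes
    \<open>p = 2\<close>.\<close>
  have "2 < ?p" using s[of 1] by auto
  then have odd: "odd ?p" by (rule prime_odd_nat[OF prime])
  have sp: "s i < ?p" if "i \<in> ?I" for i using s[OF that] by linarith

  define P where "P = (\<Prod>i\<in>?I. rising_poly (s i))"
  define E where "E = (\<Prod>i\<in>?I. fact (s i) :: int)"
  define F where "F k = (\<Prod>i\<in>?I. pochhammer (of_rat (a i)) k / of_int (fact k) :: 'p padic)" for k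
  define G where "G k = (\<Prod>i\<in>?I. of_int (?V (s i + k)) / of_int (?V (s i) * ?V k) :: 'p padic)" for k
  have cop: "coprime (fact (s i) :: int) (int ?p)" if "i \<in> ?I" for i
    using prime sp[OF that] by (rule coprime_fact_prime)
  have cE: "coprime E (int ?p)"
    unfolding E_def using cop by (intro prod_coprime_left)
  have x: "(of_rat (a i) :: 'p padic) = of_nat (?p - 1 - s i) / of_nat (?p - 1)" if "i \<in> ?I" for i
    using s[OF that] by (simp only: of_rat_divide of_rat_of_nat_eq)

  have factor_int: "padic_cong 2 (pochhammer (of_rat (a i)) k / of_int (fact k) :: 'p padic)
      (pochhammer (of_rat (a i)) k / of_int (fact k))" if "i \<in> ?I" "k < ?p" for i k
  proof -
    have "padic_cong 2 (of_rat (a i) :: 'p padic) (of_rat (a i))"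
      using padic_cong_divide_int[OF _ padic_cong_of_int_refl coprime_pred_prime, of 2 "int (?p - 1 - s i)"] p1
      by (simp add: x[OF that(1)] of_nat_diff)
    then have "padic_cong 2 (pochhammer (of_rat (a i)) k :: 'p padic) (pochhammer (of_rat (a i)) k)"
      unfolding pochhammer_prod
      by (intro padic_cong_prod padic_cong_add) (auto intro: padic_cong_of_int_refl[of 2 "int _", simplified])
    then show ?thesis using coprime_fact_prime[OF prime that(2)] by (intro padic_cong_divide_int) auto
  qed
  have FF: "padic_cong 2 (F k) (F k)" if "k < ?p" for k
    unfolding F_def by (intro padic_cong_prod factor_int that)
  have GF: "padic_cong 2 (G k) (F k + ?q * (of_nat k * (of_int (poly (pderiv P) (int k)) / of_int E)))"
    if "k < ?p" for k
    unfolding G_def F_def P_def E_def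
  proof (rule padic_cong_prod_pderiv)
    fix i assume i: "i \<in> ?I"
    note * = hypergeom_factor_cong[OF sp[OF i] that x[OF i]]
    show "padic_cong 2 (of_int (?V (s i + k)) / of_int (?V (s i) * ?V k))
        (pochhammer (of_rat (a i)) k / of_int (fact k)
         + ?q * (of_nat k * (of_int (poly (pderiv (rising_poly (s i))) (int k)) / of_int (fact (s i)))))"
      by (rule *(1))
    show "padic_cong 1 (pochhammer (of_rat (a i)) k / of_int (fact k) :: 'p padic)
        (of_int (poly (rising_poly (s i)) (int k)) / of_int (fact (s i)))"
      by (rule *(2))
    show "padic_cong 2 (pochhammer (of_rat (a i)) k / of_int (fact k) :: 'p padic)
        (pochhammer (of_rat (a i)) k / of_int (fact k))"
      using i that by (rule factor_int)
    show "coprime (fact (s i) :: int) (int ?p)" using i by (rule cop)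
  qed simp
  have FP: "padic_cong 1 (F k) (of_int (poly P (int k)) / of_int E)" if "k < ?p" for k
  proof -
    have "padic_cong 1 (F k) (\<Prod>i\<in>?I. of_int (poly (rising_poly (s i)) (int k)) / of_int (fact (s i)))"
      unfolding F_def using that by (intro padic_cong_prod hypergeom_factor_cong x sp)
    also have "(\<Prod>i\<in>?I. of_int (poly (rising_poly (s i)) (int k)) / of_int (fact (s i)))
        = (of_int (poly P (int k)) / of_int E :: 'p padic)"
      unfolding P_def E_def poly_prod of_int_prod by (rule prod_dividef)
    finally show ?thesis .
  qed

  define t where "t k = (of_nat k * (of_int (poly (pderiv P) (int k)) / of_int E) :: 'p padic)" for k
  have tt: "padic_cong l (t k) (t k)" if "l \<ge> 1" for l k
  proof -
    have "padic_cong l (of_int (int k * poly (pderiv P) (int k)) / of_int E :: 'p padic)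
        (of_int (int k * poly (pderiv P) (int k)) / of_int E)"
      using that cE by (intro padic_cong_divide_int padic_cong_of_int_refl)
    then show ?thesis by (simp add: t_def)
  qed

  define D where "D = (\<Sum>i\<in>?I. s i)"
  have D: "of_nat (?p - 1) * S = of_nat (n + 1) * of_nat (?p - 1) - (of_nat D :: rat)"
  proof -
    have "of_nat (?p - 1) * a i = of_nat (?p - 1) - of_nat (s i)" if "i \<in> ?I" for i
    proof -
      have "s i \<le> ?p - 1" using s[OF that] by linarith
      then have "(of_nat (?p - 1 - s i) :: rat) = of_nat (?p - 1) - of_nat (s i)" by (rule of_nat_diff)
      moreover have "of_nat (?p - 1) * a i = of_nat (?p - 1 - s i)"
        using s[OF that] p1' by (metis nonzero_mult_div_cancel_left times_divide_eq_right less_irrefl)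
      ultimately show ?thesis by (simp only:)
    qed
    then have "of_nat (?p - 1) * S = (\<Sum>i\<in>?I. of_nat (?p - 1) - of_nat (s i))"
      unfolding S_def sum_distrib_left by (intro sum.cong refl)
    also have "\<dots> = of_nat (n + 1) * of_nat (?p - 1) - of_nat D"
      unfolding D_def sum_subtractf of_nat_sum by (simp only: sum_constant card_atLeastAtMost diff_Suc_1 Suc_eq_plus1 diff_add_inverse2)
    finally show ?thesis .
  qed
  define q where "q = (of_nat (?p - 1) :: rat)"
  \<comment> \<open>The bound on \<open>S\<close> is exactly the degree bound
    \<open>D \<le> 2 * (p - 1)\<close>, with equality for \<open>S = n - 1\<close>.\<close>
  have q: "q > 0" and D': "of_nat (2 * (?p - 1)) - of_nat D = q * (S - (of_nat n - 1))"
    using D p1' unfolding of_nat_mult q_def[symmetric] by (simp_all add: algebra_simps)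
  have "of_nat D \<le> (of_nat (2 * (?p - 1)) :: rat)"
    using D' mult_nonneg_nonneg[of q "S - (of_nat n - 1)"] q S_ge by linarith
  then have D_le: "D \<le> 2 * (?p - 1)" by (simp only: of_nat_le_iff)
  have "S = of_nat n - 1 \<longleftrightarrow> q * (S - (of_nat n - 1)) = 0" using q by auto
  also have "\<dots> \<longleftrightarrow> (of_nat (2 * (?p - 1)) :: rat) = of_nat D" unfolding D'[symmetric] by auto
  finally have S_iff: "S = of_nat n - 1 \<longleftrightarrow> D = 2 * (?p - 1)" by (simp only: of_nat_eq_iff eq_commute)
  have degP: "degree P = D"
    unfolding P_def D_def by (rule coeff_prod_rising_poly) simp
  \<comment> \<open>As \<open>1 - a i = s i / (p - 1)\<close>, the product of gamma values is
    \<open>1 / E\<close> modulo \<open>p\<close>; if \<open>D = 2 * (p - 1)\<close>, this matches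
    the leading coefficient 1 of \<open>P\<close>.\<close>
  have delta: "padic_cong 1 (of_int (coeff P (2 * (?p - 1))) / of_int E) \<delta>"
  proof (cases "D = 2 * (?p - 1)")
    case True
    have g: "padic_cong 1 (Gamma_rat (1 - a i) :: 'p padic) (of_int 1 / of_int (fact (s i)))" if "i \<in> ?I" for i
    proof -
      have le: "s i \<le> ?p - 1" using s[OF that] by linarith
      have "1 - a i = of_nat (s i) / of_nat (?p - 1)"
      proof -
        have "a i = (of_nat (?p - 1) - of_nat (s i)) / of_nat (?p - 1)"
          using s[OF that] of_nat_diff[OF le, where 'a = rat] by (simp only:)
        then show ?thesis using p1' by (simp only: diff_divide_distrib divide_self[OF less_imp_neq[OF p1', symmetric]]) simp
      qed
      then have "padic_cong 2 (Gamma_rat (1 - a i) :: 'p padic) (of_int (Gamma_residue ?p (s i)))"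
        using Gamma_rat_cong[OF odd le] by (simp only:)
      then have "padic_cong 1 (Gamma_rat (1 - a i) :: 'p padic) (of_int (Gamma_residue ?p (s i)))"
        by (rule padic_cong_mono) simp
      also have "padic_cong 1 (of_int (Gamma_residue ?p (s i)) / of_int 1 :: 'p padic) (of_int 1 / of_int (fact (s i)))"
        using Gamma_residue_cong_inverse_fact[OF prime odd le] cop[OF that]
        by (intro padic_cong_fraction) auto
      then have "padic_cong 1 (of_int (Gamma_residue ?p (s i)) :: 'p padic) (of_int 1 / of_int (fact (s i)))"
        by simp
      finally show ?thesis .
    qed
    have "padic_cong 1 (\<Prod>i\<in>?I. Gamma_rat (1 - a i) :: 'p padic) (\<Prod>i\<in>?I. of_int 1 / of_int (fact (s i)))"
      by (intro padic_cong_prod g)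
    moreover have "(\<Prod>i\<in>?I. of_int 1 / of_int (fact (s i))) = (of_int 1 / of_int E :: 'p padic)"
      by (simp add: E_def prod_dividef)
    moreover have "coeff P (2 * (?p - 1)) = 1"
      unfolding True[symmetric] P_def D_def by (rule coeff_prod_rising_poly) simp
    moreover have "\<delta> = (\<Prod>i\<in>?I. Gamma_rat (1 - a i))"
      using \<delta>_def S_iff True by (simp only: if_True simp_thms)
    ultimately show ?thesis by (simp only: padic_cong_sym)
  next
    case False
    then have "degree P < 2 * (?p - 1)" using D_le unfolding degP by linarith
    then have "coeff P (2 * (?p - 1)) = 0" by (rule coeff_eq_0)
    moreover have "\<delta> = 0" using \<delta>_def S_iff False by (simp only: if_False)
    ultimately show ?thesis using padic_cong_of_int_refl[of 1 0, where 'p = 'p] by simp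
  qed

  \<comment> \<open>The sum in \<open>G\<close> stops at \<open>p - 2\<close>. The term at
    \<open>p - 1\<close> may be added because each of its factors is divisible by \<open>p\<close>,
    and \<open>n > 0\<close> provides at least two factors.\<close>
  have G_last: "padic_cong 2 (G (?p - 1)) 0"
  proof -
    let ?g = "\<lambda>i. of_int (?V (s i + (?p - 1))) / of_int (?V (s i) * ?V (?p - 1)) :: 'p padic"
    have g: "padic_cong 1 (?g i) 0" if "i \<in> ?I" for i
    proof -
      have "0 < s i" using s[OF that] by blast
      then have "?p \<le> s i + (?p - 1)" by linarith
      from shifted_fact_ge[OF prime this] have "int ?p dvd ?V (s i + (?p - 1))" by auto
      then have "padic_cong 1 (?g i) (of_int 0 / of_int 1)"
        using sp[OF that] p1
        by (intro padic_cong_fraction) (auto simp: cong_0_iff coprime_shifted_fact[OF prime])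
      then show ?thesis by simp
    qed
    \<comment> \<open>Only integrality is extracted from this; for \<open>n = 1\<close> the products
      are empty and the right side is 1, not 0.\<close>
    have "padic_cong 1 (\<Prod>i = 3..n + 1. ?g i) (\<Prod>i = 3..n + 1. 0)"
      by (intro padic_cong_prod g) auto
    then have "padic_cong 0 (\<Prod>i = 3..n + 1. ?g i) 0" by (rule padic_cong_0_right)
    with g[of 1] g[of 2] n have "padic_cong (1 + (1 + 0)) (?g 1 * (?g 2 * (\<Prod>i = 3..n + 1. ?g i))) 0"
      by (intro padic_cong_mult_0) auto
    moreover have "?I = insert 1 (insert 2 {3..n + 1})" using n by auto
    then have "G (?p - 1) = ?g 1 * (?g 2 * (\<Prod>i = 3..n + 1. ?g i))"
      unfolding G_def by simp
    ultimately show ?thesis by (simp add: numeral_2_eq_2)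
  qed

  \<comment> \<open>The power with exponent \<open>n + 1\<close> is distributed, one copy to each
    \<open>i\<close>.\<close>
  have "padic_G n a = - 1 / of_nat (?p - 1) * (\<Sum>j = 0..?p - 2. \<Prod>i\<in>?I.
      (- 1) ^ j * Gamma_rat (of_nat j / of_nat (?p - 1))
      * (Gamma_rat (frac (a i - of_nat j / of_nat (?p - 1))) / Gamma_rat (a i)
         * (- ?q) powi (- \<lfloor>a i - of_nat j / of_nat (?p - 1)\<rfloor>)))"
    unfolding padic_G_def Let_def prod.distrib[of "\<lambda>_. (- 1) ^ _ * Gamma_rat _"] by simp
  also have "padic_cong 2 \<dots> ((1 + ?q) * (\<Sum>j = 0..?p - 2. G j))"
  proof (rule padic_cong_mult)
    \<comment> \<open>This is \<open>(1 + p) (p - 1) = p\<^sup>2 - 1\<close>.\<close>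
    have "[- 1 * 1 = (1 + int ?p) * (int ?p - 1)] (mod int ?p ^ 2)"
      by (simp add: cong_iff_dvd_diff algebra_simps power2_eq_square)
    then have "padic_cong 2 (of_int (- 1) / of_int (int ?p - 1) :: 'p padic) (of_int (1 + int ?p) / of_int 1)"
      by (rule padic_cong_fraction[rotated]) (simp_all add: coprime_pred_prime)
    then show "padic_cong 2 (- 1 / of_nat (?p - 1) :: 'p padic) (1 + ?q)"
      using p1 by (simp add: of_nat_diff)
    show "padic_cong 2 (\<Sum>j = 0..?p - 2. \<Prod>i\<in>?I.
        (- 1) ^ j * Gamma_rat (of_nat j / of_nat (?p - 1))
        * (Gamma_rat (frac (a i - of_nat j / of_nat (?p - 1))) / Gamma_rat (a i)
           * (- ?q) powi (- \<lfloor>a i - of_nat j / of_nat (?p - 1)\<rfloor>))) (\<Sum>j = 0..?p - 2. G j)"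
      unfolding G_def
    proof (intro padic_cong_sum padic_cong_prod padic_G_factor_cong odd refl)
      fix i j assume ij: "j \<in> {0..?p - 2}" "i \<in> ?I"
      show "0 < s i" "s i < ?p" "a i = of_nat (?p - 1 - s i) / of_nat (?p - 1)"
        using s[OF ij(2)] by auto
      show "j < ?p - 1" using ij(1) p1 by auto
    qed
  qed
  also have "padic_cong 2 ((1 + ?q) * (\<Sum>j = 0..?p - 2. G j)) ((1 + ?q) * (\<Sum>k<?p. G k))"
  proof -
    have "padic_cong 2 (G k) (G k)" if "k < ?p" for k
      using GF[OF that] by (rule padic_cong_left)
    then have "padic_cong 2 (\<Sum>j = 0..?p - 2. G j) (\<Sum>j = 0..?p - 2. G j)"
      using p1 by (intro padic_cong_sum) auto
    from padic_cong_add[OF padic_cong_sym[OF G_last] this]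
    have "padic_cong 2 (\<Sum>j = 0..?p - 2. G j) (G (?p - 1) + (\<Sum>j = 0..?p - 2. G j))" by simp
    also have "G (?p - 1) + (\<Sum>j = 0..?p - 2. G j) = (\<Sum>k<?p. G k)"
    proof -
      have "{..<?p} = insert (?p - 1) {0..?p - 2}" using p1 by auto
      then show ?thesis using p1 by simp
    qed
    finally show ?thesis
      using padic_cong_of_int_refl[of 2 "1 + int ?p", where 'p = 'p] by (intro padic_cong_mult) auto
  qed
  also have "padic_cong 2 \<dots> ((1 + ?q) * (\<Sum>k<?p. F k + ?q * t k))"
    using padic_cong_of_int_refl[of 2 "1 + int ?p", where 'p = 'p] unfolding t_def
    by (intro padic_cong_mult padic_cong_sum GF) auto
  \<comment> \<open>The coefficient of \<open>p\<close> receives \<open>F k\<close> from the factor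
    \<open>1 + p\<close> and \<open>t k\<close> from the expansion of \<open>G k\<close>.\<close>
  also have "(1 + ?q) * (\<Sum>k<?p. F k + ?q * t k)
      = (\<Sum>k<?p. F k) + ?q * (\<Sum>k<?p. F k + t k) + ?q * (?q * (\<Sum>k<?p. t k))"
    by (simp only: sum.distrib sum_distrib_left[symmetric]) (simp add: algebra_simps)
  also have "padic_cong 2 \<dots> ((\<Sum>k<?p. F k) + ?q * \<delta>)"
  proof (rule padic_cong_add_prime_square)
    \<comment> \<open>Replacing \<open>F k\<close> by \<open>P(k) / E\<close> turns the summand into
      the derivative of \<open>X P\<close> at \<open>k\<close> over \<open>E\<close>, to which the
      power sums apply.\<close>
    have "padic_cong 1 (\<Sum>k<?p. F k + t k) (\<Sum>k<?p. of_int (poly P (int k)) / of_int E + t k)"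
      by (intro padic_cong_sum padic_cong_add FP tt) auto
    also have "(\<Sum>k<?p. of_int (poly P (int k)) / of_int E + t k)
        = of_int (\<Sum>k<?p. poly P (int k) + int k * poly (pderiv P) (int k)) / of_int E"
      by (simp add: t_def sum_divide_distrib add_divide_distrib)
    also have "padic_cong 1 \<dots> (of_int (coeff P (2 * (?p - 1))) / of_int E)"
      using sum_pderiv_cong[OF prime, of P] D_le degP cE
      by (intro padic_cong_divide_int padic_cong_of_int) auto
    also have "padic_cong 1 \<dots> \<delta>" by (rule delta)
    finally have "padic_cong 2 (?q * (\<Sum>k<?p. F k + t k)) (?q * \<delta>)"
      unfolding numeral_2_eq_2 One_nat_def by (rule padic_cong_prime_mult)
    then show "padic_cong 2 ((\<Sum>k<?p. F k) + ?q * (\<Sum>k<?p. F k + t k)) ((\<Sum>k<?p. F k) + ?q * \<delta>)"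
      by (intro padic_cong_add padic_cong_sum FF) auto
    show "padic_cong 2 (\<Sum>k<?p. t k) (\<Sum>k<?p. t k)"
      by (intro padic_cong_sum tt) auto
  qed
  also have "(\<Sum>k<?p. F k) = of_rat (trunc_hypergeom (map a [1..<n + 2]) (replicate n 1) 1 (?p - 1))"
  proof -
    have "{..<?p} = {..?p - 1}" using p1 by auto
    then show ?thesis unfolding trunc_hypergeom_at_1 F_def by (simp only:)
  qed
  finally show ?thesis by (simp only: mult.commute)
qed

end
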